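(* Let $R$ be a field, let $O$ and $O'$ be harmonious admissible monomial orderings on $R\langle x_1,\dots,x_n\rangle$, and let $\theta$ be the common (extendible) first ordering function of the associated functional decompositions of $O$ and $O'$. Let $G=\{g_1,\dots,g_m\}$ be a Gröbner Basis, with respect to $O$, for an ideal $J$ of $R\langle x_1,\dots,x_n\rangle$, and let $H$ be the set constructed as follows (noncommutative Gröbner Walk). Put $G'=\{\mathrm{in}_\theta(g_1),\dots,\mathrm{in}_\theta(g_m)\}$; compute a reduced Gröbner Basis $H'$ for $G'$ with respect to $O'$ (the computation is supposed to terminate); and for each $h'\in H'$ let $h'=\sum_{i=1}^{j}\ell_i g'_i r_i$ be the logged representation of $h'$ with respect to $G'$ (where $g'_i\in G'$ and the $\ell_i,r_i$ are terms) and add to $H$ (initially empty) the polynomial $\sum_{i=1}^{j}\ell_i g_i r_i$, where $\mathrm{in}_\theta(g_i)=g'_i$. Then $H$ is a Gröbner Basis for $J$ with respect to the monomial ordering $O'$.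
   Context: Ideals are two-sided. Monomials are words in the noncommuting variables $x_1,\dots,x_n$; a term is a nonzero scalar times a monomial. A monomial ordering is admissible if $1<m$ for all monomials $m\neq 1$ and $m_1<m_2$ implies $\ell m_1 r<\ell m_2 r$ for all monomials $\ell,r$. $\mathrm{LM}$ and $\mathrm{LC}$ denote leading monomial and leading coefficient. Gröbner Basis: a set $G$ generating the ideal such that all S-polynomials involving members of $G$ reduce to zero using $G$. Here, for each overlap between the leading monomials of two (not necessarily distinct) polynomials $p_1,p_2$ (one leading monomial is a subword of the other, or a proper prefix of one equals a proper suffix of the other), written $\ell_1\mathrm{LM}(p_1)r_1=\ell_2\mathrm{LM}(p_2)r_2$ with monomials such that at least one of $\ell_1,\ell_2$ and at least one of $r_1,r_2$ is $1$, the S-polynomial is $\mathrm{LC}(p_2)\ell_1p_1r_1-\mathrm{LC}(p_1)\ell_2p_2r_2$. Reduction (division) by $G$ means repeatedly subtracting multiples $c\,\mathrm{LC}(g)^{-1}u\,g\,v$ ($g\in G$, $u,v$ monomials) to cancel a term $c\,u\,\mathrm{LM}(g)\,v$. A Gröbner Basis is reduced if all its leading coefficients are $1$ and no term of an element is divisible by the leading term of another element. An ordering function is a function $\theta$ from the set of monomials to $\mathbb Z$; the $\theta$-value of a term is that of its monomial. A functional decomposition is a (possibly infinite) sequence $\Theta=\{\theta_1,\theta_2,\dots\}$ of ordering functions; it defines a monomial ordering $O$ if, for arbitrary monomials $m_1<m_2$ with respect to $O$, one has $\theta_i(m_1)<\theta_i(m_2)$ for some $i\ge1$ and $\theta_j(m_1)=\theta_j(m_2)$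 for all $1\le j<i$. For a polynomial $p$, the initial $\mathrm{in}_\theta(p)$ is made up of those terms of $p$ that have maximal $\theta$-value; $p$ is $\theta$-homogeneous if $p=\mathrm{in}_\theta(p)$. An ordering function $\theta$ is extendible if, given any $\theta$-homogeneous polynomial $p$, any multiple $upv$ of $p$ by terms $u$ and $v$ is also $\theta$-homogeneous. Two monomial orderings are harmonious if there exist functional decompositions defining them respectively whose first ordering functions are identical and extendible; these are the associated functional decompositions used in the claim. The logged representation of $h'\in H'$ with respect to $G'$ is obtained either through computing $H'$ as a Logged Gröbner Basis (i.e. computing $H'$ from $G'$ by the S-polynomial completion algorithm with respect to $O'$ followed by interreduction, while recording an explicit expression of each basis element as a sum of two-sided term multiples of elements of $G'$) or by dividing $h'$ with respect to $G'$ and recording the multiples subtracted.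
   Formalization: The formal theorem also assumes that θ(m1) < θ(m2) implies θ(u m1 v) < θ(u m2 v) for all monomials u, v; with extendibility alone the claim fails, e.g. for G = {x^2-1, x^3-x}, θ(1) = 0 and θ = 1 on all other monomials, where H = {0}. *)

theory Defs
  imports "HOL-Library.Poly_Mapping" "HOL-Library.Extended_Nat" "HOL.Hull"
begin

text \<open>
  Words form the free monoid, written additively (\<open>0\<close> is the empty word, \<open>+\<close> is concatenation), because
  the convolution product of \<open>HOL-Library.Poly_Mapping\<close> expects an additive monoid of exponents.
  With this instance \<open>'x list \<Rightarrow>\<^sub>0 'k\<close> is the free associative algebra over \<open>'k\<close> on the letters \<open>'x\<close>.
\<close>

instantiation list :: (type) monoid_add
begin
definition zero_list :: "'a list" where "zero_list = []"
definition plus_list :: "'a list \<Rightarrow> 'a list \<Rightarrow> 'a list" where "plus_list = (@)"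
instance by standard (simp_all add: zero_list_def plus_list_def)
end

type_synonym ('x, 'k) ncpoly = "'x list \<Rightarrow>\<^sub>0 'k"

abbreviation term_of :: "'k \<Rightarrow> 'x list \<Rightarrow> ('x, 'k::zero) ncpoly" where
  "term_of c m \<equiv> Poly_Mapping.single m c"

definition two_sided_ideal :: "'a::ring_1 set \<Rightarrow> bool" where
  "two_sided_ideal J \<longleftrightarrow> 0 \<in> J \<and> (\<forall>a\<in>J. \<forall>b\<in>J. a + b \<in> J) \<and> (\<forall>a\<in>J. \<forall>r s. r * a * s \<in> J)"

definition admissible_ordering :: "('x list \<Rightarrow> 'x list \<Rightarrow> bool) \<Rightarrow> bool" where
  "admissible_ordering lt \<longleftrightarrow> irreflp lt \<and> transp lt \<and> totalp lt
     \<and> (\<forall>m. m \<noteq> 0 \<longrightarrow> lt 0 m)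
     \<and> (\<forall>m1 m2 l r. lt m1 m2 \<longrightarrow> lt (l + m1 + r) (l + m2 + r))"

text \<open>Only meaningful for nonzero polynomials.\<close>

definition lm :: "('x list \<Rightarrow> 'x list \<Rightarrow> bool) \<Rightarrow> ('x, 'k::zero) ncpoly \<Rightarrow> 'x list" where
  "lm lt p = (THE m. m \<in> Poly_Mapping.keys p \<and> (\<forall>m'\<in>Poly_Mapping.keys p. m' \<noteq> m \<longrightarrow> lt m' m))"

definition lc :: "('x list \<Rightarrow> 'x list \<Rightarrow> bool) \<Rightarrow> ('x, 'k::zero) ncpoly \<Rightarrow> 'k" where
  "lc lt p = Poly_Mapping.lookup p (lm lt p)"

text \<open>
  A list of triples \<open>(l, g, r)\<close>, in which \<open>l\<close> and \<open>r\<close> are terms, records an expression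
  \<open>\<Sum> l * g * r\<close>.
\<close>

type_synonym ('x, 'k) log = "(('x, 'k) ncpoly \<times> ('x, 'k) ncpoly \<times> ('x, 'k) ncpoly) list"

definition log_sum :: "('x, 'k::field) log \<Rightarrow> ('x, 'k) ncpoly" where
  "log_sum L = (\<Sum>(l, g, r)\<leftarrow>L. l * g * r)"

text \<open>
  \<open>division lt G p Q r\<close>: some finite sequence of division steps by \<open>G\<close> leads from \<open>p\<close> to \<open>r\<close>, and \<open>Q\<close>
  records the multiples subtracted (so \<open>p = log_sum Q + r\<close>). Any term of the polynomial may be
  cancelled, and \<open>r\<close> need not be irreducible.
\<close>

inductive division ::
    "('x list \<Rightarrow> 'x list \<Rightarrow> bool) \<Rightarrow> ('x, 'k::field) ncpoly set \<Rightarrow> ('x, 'k) ncpoly \<Rightarrow> ('x, 'k) log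
      \<Rightarrow> ('x, 'k) ncpoly \<Rightarrow> bool"
  for lt G where
  division_stop: "division lt G p [] p"
| division_step: "division lt G p ((term_of (c / lc lt g) u, g, term_of 1 v) # Q) r"
    if "g \<in> G" and "g \<noteq> 0" and "c = Poly_Mapping.lookup p (u + lm lt g + v)" and "c \<noteq> 0"
      and "division lt G (p - term_of (c / lc lt g) u * g * term_of 1 v) Q r"

definition overlap :: "'x list \<Rightarrow> 'x list \<Rightarrow> 'x list \<Rightarrow> 'x list \<Rightarrow> 'x list \<Rightarrow> 'x list \<Rightarrow> bool" where
  "overlap l1 m1 r1 l2 m2 r2 \<longleftrightarrow>
     l1 + m1 + r1 = l2 + m2 + r2 \<and>
     ((l2 = 0 \<and> r2 = 0) \<or> (l1 = 0 \<and> r1 = 0) \<or>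
      (\<exists>w. l1 = 0 \<and> r2 = 0 \<and> l2 \<noteq> 0 \<and> w \<noteq> 0 \<and> r1 \<noteq> 0 \<and> m1 = l2 + w \<and> m2 = w + r1) \<or>
      (\<exists>w. l2 = 0 \<and> r1 = 0 \<and> l1 \<noteq> 0 \<and> w \<noteq> 0 \<and> r2 \<noteq> 0 \<and> m2 = l1 + w \<and> m1 = w + r2))"

definition spoly ::
    "('x list \<Rightarrow> 'x list \<Rightarrow> bool) \<Rightarrow> 'x list \<Rightarrow> ('x, 'k::field) ncpoly \<Rightarrow> 'x list
      \<Rightarrow> 'x list \<Rightarrow> ('x, 'k) ncpoly \<Rightarrow> 'x list \<Rightarrow> ('x, 'k) ncpoly" where
  "spoly lt l1 p1 r1 l2 p2 r2 =
     term_of (lc lt p2) l1 * p1 * term_of 1 r1 - term_of (lc lt p1) l2 * p2 * term_of 1 r2"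

definition groebner_basis ::
    "('x list \<Rightarrow> 'x list \<Rightarrow> bool) \<Rightarrow> ('x, 'k::field) ncpoly set \<Rightarrow> ('x, 'k) ncpoly set \<Rightarrow> bool" where
  "groebner_basis lt G J \<longleftrightarrow>
     two_sided_ideal hull G = J \<and>
     (\<forall>p1\<in>G. \<forall>p2\<in>G. \<forall>l1 r1 l2 r2.
        p1 \<noteq> 0 \<longrightarrow> p2 \<noteq> 0 \<longrightarrow> overlap l1 (lm lt p1) r1 l2 (lm lt p2) r2 \<longrightarrow>
        (\<exists>Q. division lt G (spoly lt l1 p1 r1 l2 p2 r2) Q 0))"

definition reduced_groebner_basis ::
    "('x list \<Rightarrow> 'x list \<Rightarrow> bool) \<Rightarrow> ('x, 'k::field) ncpoly set \<Rightarrow> ('x, 'k) ncpoly set \<Rightarrow> bool" where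
  "reduced_groebner_basis lt G J \<longleftrightarrow>
     groebner_basis lt G J \<and>
     (\<forall>g\<in>G. lc lt g = 1) \<and>
     (\<forall>g\<in>G. \<forall>h\<in>G. g \<noteq> h \<longrightarrow> (\<forall>m\<in>Poly_Mapping.keys g. \<nexists>u v. m = u + lm lt h + v))"

text \<open>
  The sequence has \<open>N\<close> entries (\<open>N = \<infinity>\<close> allowed); indices start at \<open>0\<close> instead of \<open>1\<close>.
\<close>

definition decomposition_defines ::
    "enat \<Rightarrow> (nat \<Rightarrow> 'x list \<Rightarrow> int) \<Rightarrow> ('x list \<Rightarrow> 'x list \<Rightarrow> bool) \<Rightarrow> bool" where
  "decomposition_defines N \<Theta> lt \<longleftrightarrow>
     (\<forall>m1 m2. lt m1 m2 \<longrightarrow>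
        (\<exists>i. enat i < N \<and> \<Theta> i m1 < \<Theta> i m2 \<and> (\<forall>j<i. \<Theta> j m1 = \<Theta> j m2)))"

definition initial :: "('x list \<Rightarrow> int) \<Rightarrow> ('x, 'k::comm_monoid_add) ncpoly \<Rightarrow> ('x, 'k) ncpoly" where
  "initial \<theta> p = (\<Sum>m \<in> {m \<in> Poly_Mapping.keys p. \<forall>m'\<in>Poly_Mapping.keys p. \<theta> m' \<le> \<theta> m}. term_of (Poly_Mapping.lookup p m) m)"

definition homogeneous :: "('x list \<Rightarrow> int) \<Rightarrow> ('x, 'k::comm_monoid_add) ncpoly \<Rightarrow> bool" where
  "homogeneous \<theta> p \<longleftrightarrow> p = initial \<theta> p"

text \<open>The additional argument fixes the coefficient field of the polynomials quantified over.\<close>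

definition extendible :: "'k::field itself \<Rightarrow> ('x list \<Rightarrow> int) \<Rightarrow> bool" where
  "extendible k \<theta> \<longleftrightarrow>
     (\<forall>(p :: ('x, 'k) ncpoly) c u d v. homogeneous \<theta> p \<longrightarrow> c \<noteq> 0 \<longrightarrow> d \<noteq> 0 \<longrightarrow>
        homogeneous \<theta> (term_of c u * p * term_of d v))"

text \<open>
  Not a consequence of extendibility, even for the first function of a decomposition of an admissible
  ordering: take \<open>\<theta> 0 = 0\<close> and \<open>\<theta> m = 1\<close> for \<open>m \<noteq> 0\<close>. It amounts to
  \<open>initial \<theta> (u * p * v) = u * initial \<theta> p * v\<close> for extendible \<open>\<theta>\<close>, terms \<open>u\<close>, \<open>v\<close> and all \<open>p\<close>. Without it the
  walk can fail: with one letter \<open>x\<close>, the \<open>\<theta>\<close> just given and both orderings by degree, the basis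
  \<open>{x\<^sup>2 - 1, x\<^sup>3 - x}\<close> has initials \<open>{x\<^sup>2, x\<^sup>3 - x}\<close>, whose reduced basis \<open>{x}\<close>, with
  \<open>x = x\<^sup>2 * x - (x\<^sup>3 - x)\<close>, lifts to \<open>{0}\<close>.
\<close>

definition strictly_compatible :: "('x list \<Rightarrow> int) \<Rightarrow> bool" where
  "strictly_compatible \<theta> \<longleftrightarrow> (\<forall>m1 m2 u v. \<theta> m1 < \<theta> m2 \<longrightarrow> \<theta> (u + m1 + v) < \<theta> (u + m2 + v))"

text \<open>\<open>lt\<close> and \<open>lt'\<close> are harmonious, with \<open>\<theta>\<close> the common first ordering function.\<close>

definition harmonious_via ::
    "'k::field itself \<Rightarrow> ('x list \<Rightarrow> int) \<Rightarrow> ('x list \<Rightarrow> 'x list \<Rightarrow> bool) \<Rightarrow> ('x list \<Rightarrow> 'x list \<Rightarrow> bool)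
      \<Rightarrow> bool" where
  "harmonious_via k \<theta> lt lt' \<longleftrightarrow>
     (\<exists>N \<Theta> N' \<Theta>'. 0 < N \<and> 0 < N' \<and> decomposition_defines N \<Theta> lt \<and> decomposition_defines N' \<Theta>' lt'
        \<and> \<Theta> 0 = \<theta> \<and> \<Theta>' 0 = \<theta>) \<and> extendible k \<theta>"

text \<open>
  Logged computation of a reduced Groebner basis of the ideal generated by \<open>G'\<close>. A state \<open>(P, K)\<close> consists of
  the current set \<open>P\<close> of polynomials and, for each \<open>p \<in> P\<close>, an expression \<open>K p\<close> of \<open>p\<close> over \<open>G'\<close>.
\<close>

type_synonym ('x, 'k) logged_state =
  "('x, 'k) ncpoly set \<times> (('x, 'k) ncpoly \<Rightarrow> ('x, 'k) log)"

definition log_mult :: "('x, 'k::field) ncpoly \<Rightarrow> ('x, 'k) log \<Rightarrow> ('x, 'k) ncpoly \<Rightarrow> ('x, 'k) log" where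
  "log_mult a L b = map (\<lambda>(l, g, r). (a * l, g, r * b)) L"

text \<open>Turns an expression over the current set into one over \<open>G'\<close>.\<close>

definition log_subst ::
    "(('x, 'k::field) ncpoly \<Rightarrow> ('x, 'k) log) \<Rightarrow> ('x, 'k) log \<Rightarrow> ('x, 'k) log" where
  "log_subst K Q = concat (map (\<lambda>(a, p, b). log_mult a (K p) b) Q)"

definition spoly_log ::
    "('x list \<Rightarrow> 'x list \<Rightarrow> bool) \<Rightarrow> 'x list \<Rightarrow> ('x, 'k::field) ncpoly \<Rightarrow> 'x list
      \<Rightarrow> 'x list \<Rightarrow> ('x, 'k) ncpoly \<Rightarrow> 'x list \<Rightarrow> ('x, 'k) log" where
  "spoly_log lt l1 p1 r1 l2 p2 r2 =
     [(term_of (lc lt p2) l1, p1, term_of 1 r1), (term_of (- lc lt p1) l2, p2, term_of 1 r2)]"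

inductive completion_step ::
    "('x list \<Rightarrow> 'x list \<Rightarrow> bool) \<Rightarrow> ('x, 'k::field) logged_state \<Rightarrow> ('x, 'k) logged_state \<Rightarrow> bool"
  for lt where
  "completion_step lt (P, K)
     (insert r P, K(r := log_subst K (spoly_log lt l1 p1 r1 l2 p2 r2 @ log_mult (- 1) Q 1)))"
  if "p1 \<in> P" and "p2 \<in> P" and "p1 \<noteq> 0" and "p2 \<noteq> 0"
    and "overlap l1 (lm lt p1) r1 l2 (lm lt p2) r2"
    and "division lt P (spoly lt l1 p1 r1 l2 p2 r2) Q r" and "r \<noteq> 0"

inductive interreduction_step ::
    "('x list \<Rightarrow> 'x list \<Rightarrow> bool) \<Rightarrow> ('x, 'k::field) logged_state \<Rightarrow> ('x, 'k) logged_state \<Rightarrow> bool"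
  for lt where
  discard: "interreduction_step lt (P, K) (P - {p}, K)"
  if "p \<in> P" and "division lt (P - {p}) p Q 0"
| replace: "interreduction_step lt (P, K)
     (insert r (P - {p}), K(r := log_subst K ((1, p, 1) # log_mult (- 1) Q 1)))"
  if "p \<in> P" and "division lt (P - {p}) p Q r" and "r \<noteq> 0"
| normalise: "interreduction_step lt (P, K)
     (insert r (P - {p}), K(r := log_mult (term_of (inverse (lc lt p)) 0) (K p) 1))"
  if "p \<in> P" and "p \<noteq> 0" and "r = term_of (inverse (lc lt p)) 0 * p"

definition logged_groebner_basis ::
    "('x list \<Rightarrow> 'x list \<Rightarrow> bool) \<Rightarrow> ('x, 'k::field) ncpoly set \<Rightarrow> ('x, 'k) ncpoly set
      \<Rightarrow> (('x, 'k) ncpoly \<Rightarrow> ('x, 'k) log) \<Rightarrow> bool" where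
  "logged_groebner_basis lt G' H' K \<longleftrightarrow>
     (\<exists>P1 K1. (completion_step lt)\<^sup>*\<^sup>* (G', \<lambda>g. [(1, g, 1)]) (P1, K1)
        \<and> groebner_basis lt P1 (two_sided_ideal hull G')
        \<and> (interreduction_step lt)\<^sup>*\<^sup>* (P1, K1) (H', K)
        \<and> reduced_groebner_basis lt H' (two_sided_ideal hull G'))"

text \<open>
  The division of \<open>h'\<close> by \<open>G'\<close> may be carried out with respect to either ordering.
\<close>

definition logged_representation ::
    "('x list \<Rightarrow> 'x list \<Rightarrow> bool) \<Rightarrow> ('x list \<Rightarrow> 'x list \<Rightarrow> bool) \<Rightarrow> ('x, 'k::field) ncpoly set
      \<Rightarrow> ('x, 'k) ncpoly set \<Rightarrow> ('x, 'k) ncpoly \<Rightarrow> ('x, 'k) log \<Rightarrow> bool" where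
  "logged_representation lt lt' G' H' h' L \<longleftrightarrow>
     (\<exists>K. logged_groebner_basis lt' G' H' K \<and> L = K h')
     \<or> division lt G' h' L 0 \<or> division lt' G' h' L 0"

definition lifts ::
    "('x list \<Rightarrow> int) \<Rightarrow> ('x, 'k::field) ncpoly set \<Rightarrow> ('x, 'k) log \<Rightarrow> ('x, 'k) ncpoly \<Rightarrow> bool" where
  "lifts \<theta> G L h \<longleftrightarrow>
     (\<exists>M. list_all2 (\<lambda>(l, g', r) (l', g, r'). l' = l \<and> r' = r \<and> g \<in> G \<and> initial \<theta> g = g') L M
        \<and> h = log_sum M)"

definition groebner_walk ::
    "('x list \<Rightarrow> int) \<Rightarrow> ('x list \<Rightarrow> 'x list \<Rightarrow> bool) \<Rightarrow> ('x list \<Rightarrow> 'x list \<Rightarrow> bool)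
      \<Rightarrow> ('x, 'k::field) ncpoly set \<Rightarrow> ('x, 'k) ncpoly set \<Rightarrow> bool" where
  "groebner_walk \<theta> lt lt' G H \<longleftrightarrow>
     (\<exists>H' f. finite H'
        \<and> reduced_groebner_basis lt' H' (two_sided_ideal hull (initial \<theta> ` G))
        \<and> (\<forall>h'\<in>H'. \<exists>L. logged_representation lt lt' (initial \<theta> ` G) H' h' L \<and> lifts \<theta> G L (f h'))
        \<and> H = f ` H')"

end

theory Submission
  imports Defs
begin

text \<open>
  By the diamond lemma every \<open>p \<in> J\<close> is divided to zero by \<open>G\<close>, so \<open>in(p)\<close> lies in the ideal
  generated by the initials \<open>G'\<close>, whence \<open>LM'(p) = LM'(in(p))\<close> is divisible by some \<open>LM'(h')\<close> with
  \<open>h' \<in> H'\<close>. The elements of \<open>H'\<close> are \<open>\<theta>\<close>-homogeneous because the ideal of \<open>G'\<close> is graded and \<open>H'\<close> is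
  reduced; all logged multiples in the representation of \<open>h'\<close> have the \<open>\<theta>\<close>-value of \<open>h'\<close>, so the lift \<open>h\<close>
  has initial \<open>h'\<close> and \<open>LM'(h) = LM'(h')\<close>. Hence the leading monomials of \<open>H\<close> divide those of
  \<open>J\<close>, which makes \<open>H\<close> a Groebner basis since admissible orderings are well-founded.
\<close>

section \<open>Ideals and spans of two-sided multiples\<close>

text \<open>Cancellation turns \<open>u + k + v = u + m + v\<close> into \<open>k = m\<close>, so
  multiplication by terms on both sides acts injectively on words and coefficients of multiples can
  be read off.\<close>

instance list :: (type) cancel_semigroup_add
  by standard (simp_all add: plus_list_def)

abbreviation (input) "keys \<equiv> Poly_Mapping.keys"
abbreviation (input) "lookup \<equiv> Poly_Mapping.lookup"

text \<open>A normal form for two-sided term multiples: the scalar is central, so all of it is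
  collected in the left factor; see \<open>term_mult_term_eq_multiple\<close>.\<close>

abbreviation multiple :: "'k::field \<Rightarrow> 'x list \<Rightarrow> ('x, 'k) ncpoly \<Rightarrow> 'x list \<Rightarrow> ('x, 'k) ncpoly" where
  "multiple c u p v \<equiv> term_of c u * p * term_of 1 v"

lemma sum_terms_eq:
  "(\<Sum>m\<in>keys p. term_of (lookup p m) m) = p"
proof (rule poly_mapping_eqI)
  fix k
  have "(\<Sum>m\<in>keys p. lookup p m when m = k) = lookup p k"
    by (cases "k \<in> keys p")
      (simp_all add: when_def sum.delta in_keys_iff)
  then show "lookup (\<Sum>m\<in>keys p. term_of (lookup p m) m) k = lookup p k"
    by (simp add: lookup_sum lookup_single)
qed

lemma term_mult_term:
  fixes p :: "('x, 'k::field) ncpoly"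
  shows "term_of c u * p * term_of d v = (\<Sum>m\<in>keys p. term_of (c * lookup p m * d) (u + m + v))"
  by (subst sum_terms_eq[of p, symmetric])
    (simp add: sum_distrib_left sum_distrib_right mult_single)

lemma lookup_term_mult_term:
  fixes p :: "('x, 'k::field) ncpoly"
  shows "lookup (term_of c u * p * term_of d v) (u + m + v) = c * lookup p m * d"
proof -
  have "lookup (term_of c u * p * term_of d v) (u + m + v)
      = (\<Sum>k\<in>keys p. if k = m then c * lookup p k * d else 0)"
    by (simp add: term_mult_term lookup_sum lookup_single when_def)
  also have "\<dots> = c * lookup p m * d"
    by (simp add: sum.delta' in_keys_iff)
  finally show ?thesis .
qed

lemma keys_term_mult_term:
  fixes p :: "('x, 'k::field) ncpoly"
  shows "keys (term_of c u * p * term_of d v) \<subseteq> (\<lambda>m. u + m + v) ` keys p"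
  unfolding term_mult_term
  by (rule order_trans[OF keys_sum]) (auto split: if_splits)

lemma keys_term_mult_term_nz:
  fixes p :: "('x, 'k::field) ncpoly"
  assumes "c \<noteq> 0" "d \<noteq> 0"
  shows "keys (term_of c u * p * term_of d v) = (\<lambda>m. u + m + v) ` keys p"
  using keys_term_mult_term[where c = c and u = u and p = p and d = d and v = v] assms
  by (auto simp: in_keys_iff lookup_term_mult_term)

lemma term_mult_term_eq_multiple:
  fixes p :: "('x, 'k::field) ncpoly"
  shows "term_of c u * p * term_of d v = multiple (c * d) u p v"
  unfolding term_mult_term by (simp only: mult_1_left mult_1_right mult_ac)

lemma term_mult_multiple:
  "term_of c u * multiple a u' g v' * term_of d v = multiple (c * a * d) (u + u') g (v' + v)"
proof -
  have "term_of c u * multiple a u' g v' * term_of d v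
      = (term_of c u * term_of a u') * g * (term_of 1 v' * term_of d v)"
    by (simp only: mult.assoc)
  also have "\<dots> = multiple (c * a * d) (u + u') g (v' + v)"
    by (simp only: mult_single mult_1_left term_mult_term_eq_multiple[where d = d])
  finally show ?thesis .
qed

lemma two_sided_ideal_hull: "two_sided_ideal (two_sided_ideal hull S)"
  by (simp add: two_sided_ideal_def hull_def)

lemma zero_in_hull: "0 \<in> two_sided_ideal hull S"
  using two_sided_ideal_hull[of S] by (auto simp only: two_sided_ideal_def)

lemma two_sided_ideal_mult: "two_sided_ideal J \<Longrightarrow> a \<in> J \<Longrightarrow> r * a * s \<in> J"
  by (auto simp: two_sided_ideal_def)

lemma two_sided_ideal_add: "two_sided_ideal J \<Longrightarrow> a \<in> J \<Longrightarrow> b \<in> J \<Longrightarrow> a + b \<in> J"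
  by (auto simp: two_sided_ideal_def)

lemma two_sided_ideal_diff: "two_sided_ideal J \<Longrightarrow> a \<in> J \<Longrightarrow> b \<in> J \<Longrightarrow> a - b \<in> J"
  using two_sided_ideal_mult[of J b "- 1" 1] two_sided_ideal_add[of J a "- b"] by simp

text \<open>The set \<open>S\<close> controls the leading words of the summands. For
  \<open>S = UNIV\<close> the span contains the generated ideal; for \<open>S = below w\<close> it
  is the space of relations below \<open>w\<close> used in Bergman's diamond lemma.\<close>

inductive_set spanned :: "('x list \<Rightarrow> 'x list \<Rightarrow> bool) \<Rightarrow> ('x, 'k::field) ncpoly set \<Rightarrow> 'x list set
    \<Rightarrow> ('x, 'k) ncpoly set" for lt G S where
  zero: "0 \<in> spanned lt G S"
| step: "g \<in> G \<Longrightarrow> g \<noteq> 0 \<Longrightarrow> u + lm lt g + v \<in> S \<Longrightarrow> q \<in> spanned lt G S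
    \<Longrightarrow> multiple c u g v + q \<in> spanned lt G S"

lemma spanned_mono: "S \<subseteq> T \<Longrightarrow> spanned lt G S \<subseteq> spanned lt G T"
proof
  fix p assume "S \<subseteq> T" "p \<in> spanned lt G S"
  from this(2,1) show "p \<in> spanned lt G T"
    by (induction rule: spanned.induct) (auto intro: spanned.intros)
qed

lemma spanned_multiple:
  "g \<in> G \<Longrightarrow> g \<noteq> 0 \<Longrightarrow> u + lm lt g + v \<in> S \<Longrightarrow> multiple c u g v \<in> spanned lt G S"
  using spanned.step[OF _ _ _ spanned.zero, of g G u lt v S c] by simp

lemma spanned_add:
  "p \<in> spanned lt G S \<Longrightarrow> q \<in> spanned lt G S \<Longrightarrow> p + q \<in> spanned lt G S"
proof (induction rule: spanned.induct)
  case (step g u v p c)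
  then show ?case
    using spanned.step[of g G u lt v S "p + q" c] by (simp add: add.assoc)
qed simp

lemma spanned_term_mult:
  assumes "p \<in> spanned lt G S" and "\<And>w. w \<in> S \<Longrightarrow> u + w + v \<in> T"
  shows "term_of c u * p * term_of d v \<in> spanned lt G T"
  using assms(1)
proof (induction rule: spanned.induct)
  case zero
  then show ?case by (simp add: spanned.zero)
next
  case (step g u' v' q a)
  have "term_of c u * (multiple a u' g v' + q) * term_of d v
      = multiple (c * a * d) (u + u') g (v' + v) + term_of c u * q * term_of d v"
    by (simp only: distrib_left distrib_right term_mult_multiple)
  moreover have "(u + u') + lm lt g + (v' + v) \<in> T"
    using assms(2)[OF step(3)] by (simp add: add.assoc)
  ultimately show ?case
    using spanned.step[OF step(1,2) _ step.IH] by metis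
qed

lemma spanned_scale: "p \<in> spanned lt G S \<Longrightarrow> term_of c 0 * p \<in> spanned lt G S"
  using spanned_term_mult[of p lt G S 0 0 S c 1] by simp

lemma spanned_uminus: "p \<in> spanned lt G S \<Longrightarrow> - p \<in> spanned lt G S"
  using spanned_scale[of p lt G S "- 1"] by (simp add: single_uminus)

lemma spanned_diff:
  "p \<in> spanned lt G S \<Longrightarrow> q \<in> spanned lt G S \<Longrightarrow> p - q \<in> spanned lt G S"
  using spanned_add[of p lt G S "- q"] by (simp add: spanned_uminus)

lemma spanned_sum:
  "(\<And>i. i \<in> I \<Longrightarrow> f i \<in> spanned lt G S) \<Longrightarrow> sum f I \<in> spanned lt G S"
  by (induction I rule: infinite_finite_induct) (simp_all add: spanned.zero spanned_add)

lemma spanned_UNIV_ideal: "two_sided_ideal (spanned lt G UNIV)"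
proof -
  have "r * p * s \<in> spanned lt G UNIV" if "p \<in> spanned lt G UNIV" for p r s
  proof -
    have "r * p * s = (\<Sum>u\<in>keys r. term_of (lookup r u) u) * p * (\<Sum>v\<in>keys s. term_of (lookup s v) v)"
      by (simp only: sum_terms_eq)
    also have "\<dots> = (\<Sum>v\<in>keys s. \<Sum>u\<in>keys r. term_of (lookup r u) u * p * term_of (lookup s v) v)"
      by (simp only: sum_distrib_left sum_distrib_right)
    also have "\<dots> \<in> spanned lt G UNIV"
      by (intro spanned_sum spanned_term_mult[OF that]) simp
    finally show ?thesis .
  qed
  then show ?thesis
    by (auto simp: two_sided_ideal_def spanned.zero spanned_add)
qed

lemma hull_subset_spanned: "two_sided_ideal hull G \<subseteq> spanned lt G UNIV"
proof (intro hull_minimal spanned_UNIV_ideal)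
  show "G \<subseteq> spanned lt G UNIV"
  proof
    fix g assume "g \<in> G"
    then show "g \<in> spanned lt G UNIV"
      using spanned_multiple[of g G 0 lt 0 UNIV 1]
      by (cases "g = 0") (simp_all add: spanned.zero)
  qed
qed

lemma division_imp_sum: "division lt G p Q r \<Longrightarrow> p = log_sum Q + r"
  by (induction rule: division.induct) (simp_all add: log_sum_def algebra_simps)

lemma division_diff_mem:
  assumes "division lt G p Q r" and "G \<subseteq> J" and "two_sided_ideal J"
  shows "p - r \<in> J"
  using assms(1)
proof (induction rule: division.induct)
  case (division_stop p)
  then show ?case using assms by (simp add: two_sided_ideal_def)
next
  case (division_step g c p u v Q r)
  have "multiple (c / lc lt g) u g v \<in> J"
    using assms division_step by (auto intro: two_sided_ideal_mult)
  then show ?case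
    using two_sided_ideal_add[OF assms(3) _ division_step.IH] by fastforce
qed

section \<open>Division and the diamond lemma\<close>

text \<open>The ideal-theoretic form of the Groebner property. It speaks of leading monomials only,
  so it can be passed from \<open>H'\<close> to the lifted set;
  \<open>groebner_basis_lead_divisible\<close> and \<open>groebner_basisI\<close> link it to
  S-polynomials.\<close>

definition lead_divisible :: "('x list \<Rightarrow> 'x list \<Rightarrow> bool) \<Rightarrow> ('x, 'k::field) ncpoly set
    \<Rightarrow> ('x, 'k) ncpoly set \<Rightarrow> bool" where
  "lead_divisible lt G J \<longleftrightarrow>
     (\<forall>p\<in>J. p \<noteq> 0 \<longrightarrow> (\<exists>g\<in>G. \<exists>u v. g \<noteq> 0 \<and> lm lt p = u + lm lt g + v))"

text \<open>Two occurrences in one word either have a possibly empty gap \<open>t\<close> between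
  them, or stripping their common context \<open>u\<close>, \<open>v\<close> leaves an overlap of
  the kind for which an S-polynomial is formed.\<close>

lemma overlap_cases:
  fixes u1 m1 v1 u2 m2 v2 :: "'x list"
  assumes eq: "u1 + m1 + v1 = u2 + m2 + v2" and len: "length u1 \<le> length u2"
  obtains (disjoint) t where "u2 = u1 + m1 + t" "v1 = t + m2 + v2"
  | (overlap) u v l1 r1 l2 r2 where "overlap l1 m1 r1 l2 m2 r2"
      "u1 = u + l1" "v1 = r1 + v" "u2 = u + l2" "v2 = r2 + v"
proof -
  obtain s where u2: "u2 = u1 + s"
    using eq len by (auto simp: plus_list_def append_eq_append_conv2)
  then have eq': "m1 + v1 = s + (m2 + v2)"
    using eq by (simp add: add.assoc)
  \<comment> \<open>The word \<open>s\<close> is the offset between the two starting positions: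
    either it covers all of \<open>m1\<close>, or \<open>w\<close> is the rest of \<open>m1\<close>
    from the start of \<open>m2\<close> on.\<close>
  then consider t where "s = m1 + t" "v1 = t + (m2 + v2)"
    | w where "m1 = s + w" "w + v1 = m2 + v2"
    by (auto simp: plus_list_def append_eq_append_conv2)
  then show thesis
  proof cases
    case 1
    then show thesis using disjoint u2 by (simp add: add.assoc)
  next
    case w: 2
    then consider t where "w = m2 + t" "v2 = t + v1" | t where "m2 = w + t" "v1 = t + v2"
      by (auto simp: plus_list_def append_eq_append_conv2)
    then show thesis
    proof cases
      case 1
      have ov: "overlap 0 m1 0 s m2 t"
        using w 1 by (simp add: overlap_def add.assoc)
      show thesis using 1 u2 by (intro overlap[OF ov, where u = u1 and v = v1]) simp_all
    next
      case 2
      show thesis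
      \<comment> \<open>A proper prefix-suffix overlap has all three words nonempty. Otherwise
        \<open>w = 0\<close> means adjacent occurrences, and \<open>s = 0\<close> or
        \<open>t = 0\<close> means that one word contains the other.\<close>
      proof (cases "w = 0 \<or> s = 0 \<or> t = 0")
        case False
        then have ov: "overlap 0 m1 t s m2 0"
          using w 2 by (simp add: overlap_def add.assoc)
        show thesis using 2 u2 by (intro overlap[OF ov, where u = u1 and v = v2]) simp_all
      next
        case True
        then consider "w = 0" | "s = 0" | "t = 0" by blast
        then show thesis
        proof cases
          case 1
          then show thesis using 2 w u2 by (intro disjoint[of 0]) simp_all
        next
          case s: 2
          then have ov: "overlap 0 m1 t s m2 0"
            using w 2 s by (simp add: overlap_def)
          show thesis using 2 u2 by (intro overlap[OF ov, where u = u1 and v = v2]) simp_all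
        next
          case 3
          then have ov: "overlap 0 m1 t s m2 0"
            using w 2 by (simp add: overlap_def)
          show thesis using 2 u2 by (intro overlap[OF ov, where u = u1 and v = v2]) simp_all
        qed
      qed
    qed
  qed
qed

text \<open>The finite alphabet enters through well-foundedness: infinitely many letters could form
  a descending chain.\<close>

locale admissible =
  fixes lt :: "'x::finite list \<Rightarrow> 'x list \<Rightarrow> bool"
  assumes admissible: "admissible_ordering lt"
begin

lemma lt_irrefl: "\<not> lt a a"
  using admissible by (auto simp: admissible_ordering_def irreflp_def)

lemma lt_trans: "lt a b \<Longrightarrow> lt b c \<Longrightarrow> lt a c"
  using admissible by (auto simp: admissible_ordering_def dest: transpD)

lemma lt_total: "a \<noteq> b \<Longrightarrow> lt a b \<or> lt b a"
  using admissible by (auto simp: admissible_ordering_def totalp_on_def)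

lemma zero_lt: "m \<noteq> 0 \<Longrightarrow> lt 0 m"
  using admissible by (auto simp: admissible_ordering_def)

lemma lt_mult: "lt a b \<Longrightarrow> lt (u + a + v) (u + b + v)"
  using admissible by (auto simp: admissible_ordering_def)

text \<open>By totality the alternatives are \<open>a = b\<close> and \<open>lt b a\<close>, and
  both contradict the inequality of the products.\<close>

lemma lt_mult_cancel: "lt (u + a + v) (u + b + v) \<Longrightarrow> lt a b"
  using lt_total[of a b] lt_mult[of b a u v] lt_trans lt_irrefl by blast

lemma factor_le: "w = m \<or> lt m w" if "w = u + m + v"
proof -
  have "u + m = m \<or> lt m (u + m)"
    using lt_mult[of 0 u 0 m] zero_lt[of u] by (cases "u = 0") simp_all
  moreover have "w = u + m \<or> lt (u + m) w"
    using lt_mult[of 0 v "u + m" 0] zero_lt[of v] that by (cases "v = 0") simp_all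
  ultimately show ?thesis using lt_trans by metis
qed

text \<open>
  A descending chain all of whose members are chosen as short as possible contains infinitely many words
  with the same first letter. Deleting that letter gives a descending chain again, starting with a
  shorter word: the minimal bad sequence argument for Higman's lemma.
\<close>

lemma wfp_lt: "wfp lt"
proof -
  have "Wellfounded.accp lt w0" for w0
  proof (rule ccontr)
    define bad where "bad w \<longleftrightarrow> \<not> Wellfounded.accp lt w" for w
    assume "\<not> Wellfounded.accp lt w0"
    then have bad0: "bad w0" by (simp add: bad_def)
    have down: "\<exists>w'. bad w' \<and> lt w' w" if "bad w" for w
      using that unfolding bad_def by (meson accp.accI)
    \<comment> \<open>The next member of the chain is a shortest inaccessible word below the present
      one.\<close>
    define nxt where "nxt w = (ARG_MIN length w'. bad w' \<and> lt w' w)" for w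
    have nxt: "bad (nxt w) \<and> lt (nxt w) w" if "bad w" for w
      unfolding nxt_def using down[OF that] by (metis (mono_tags, lifting) arg_min_natI)
    have nxt_min: "length (nxt w) \<le> length w'" if "bad w'" "lt w' w" for w w'
      unfolding nxt_def using that arg_min_nat_le[of "\<lambda>w'. bad w' \<and> lt w' w" w' length] by blast
    define s where "s n = (nxt ^^ n) w0" for n
    have s_Suc: "s (Suc n) = nxt (s n)" for n by (simp add: s_def)
    have s_bad: "bad (s n)" for n
      by (induction n) (use bad0 nxt s_Suc in \<open>auto simp: s_def\<close>)
    have s_desc: "lt (s j) (s i)" if "i < j" for i j
      using that by (induction rule: less_Suc_induct) (use nxt s_bad s_Suc lt_trans in metis)+
    have s_ne: "s i \<noteq> []" for i
      using down[OF s_bad[of i]] zero_lt lt_trans lt_irrefl by (metis zero_list_def)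
    \<comment> \<open>Index 0 is left out because \<open>s 0\<close> is an arbitrary inaccessible
      word; only the later members were chosen of minimal length.\<close>
    obtain i0 where inf: "infinite {i \<in> {0<..}. hd (s i) = hd (s i0)}"
      using pigeonhole_infinite[of "{0::nat<..}" "\<lambda>i. hd (s i)"] infinite_Ioi by auto
    define I where "I = {i \<in> {0<..}. hd (s i) = hd (s i0)}"
    define x where "x = hd (s i0)"
    have I: "infinite I" "\<And>i. i \<in> I \<Longrightarrow> 0 < i \<and> s i = [x] + tl (s i)"
      using inf s_ne by (auto simp: I_def x_def plus_list_def) (metis list.collapse)
    \<comment> \<open>The tails indexed by \<open>I\<close> descend without end, so an accessible
      one would lead by induction to a contradiction at a later index.\<close>
    have "\<forall>i\<in>I. v \<noteq> tl (s i)" if "Wellfounded.accp lt v" for v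
      using that
    proof (induction rule: accp.induct)
      case (accI v)
      show ?case
      proof (intro ballI notI)
        fix i assume i: "i \<in> I" "v = tl (s i)"
        obtain j where j: "j \<in> I" "i < j"
          using I(1) by (meson infinite_nat_iff_unbounded)
        have "lt ([x] + tl (s j) + 0) ([x] + tl (s i) + 0)"
          using s_desc[OF j(2)] I(2)[OF i(1)] I(2)[OF j(1)] by simp
        then have "lt (tl (s j)) v" using i(2) lt_mult_cancel by blast
        then show False using accI j(1) by blast
      qed
    qed
    then have bad_tl: "bad (tl (s i))" if "i \<in> I" for i
      using that by (auto simp: bad_def)
    obtain i where i: "i \<in> I" using I(1) by fastforce
    then obtain j where j: "i = Suc j" using I(2) by (meson gr0_implies_Suc)
    \<comment> \<open>The tail is an inaccessible word below the predecessor \<open>s j\<close> and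
      shorter than \<open>s i\<close>, against the choice of \<open>s i\<close>.\<close>
    have "lt (tl (s i)) (s i)"
      using I(2)[OF i] lt_mult[of 0 "[x]" 0 "tl (s i)"] zero_lt[of "[x]"]
      by (simp add: zero_list_def plus_list_def)
    then have "lt (tl (s i)) (s j)"
      using s_desc[of j i] j lt_trans by blast
    then have "length (s i) \<le> length (tl (s i))"
      using nxt_min[OF bad_tl[OF i]] j s_Suc by metis
    then show False using s_ne[of i] by (cases "s i") simp_all
  qed
  then show ?thesis by (simp add: accp_wfpI)
qed

abbreviation "below w \<equiv> {w'. lt w' w}"
abbreviation "atmost w \<equiv> insert w (below w)"

section \<open>Leading monomials and down-closed supports\<close>

lemma lm_eqI:
  assumes "w \<in> keys p" and "keys p \<subseteq> atmost w"
  shows "lm lt p = w"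
  unfolding lm_def
proof (rule the_equality)
  show "w \<in> keys p \<and> (\<forall>m\<in>keys p. m \<noteq> w \<longrightarrow> lt m w)"
    using assms by blast
next
  fix m assume m: "m \<in> keys p \<and> (\<forall>m'\<in>keys p. m' \<noteq> m \<longrightarrow> lt m' m)"
  show "m = w"
  proof (rule ccontr)
    assume "m \<noteq> w"
    then have "lt w m" "lt m w" using m assms by auto
    then show False using lt_trans lt_irrefl by blast
  qed
qed

lemma finite_max:
  assumes "finite A" "A \<noteq> {}"
  shows "\<exists>w\<in>A. A \<subseteq> atmost w"
  using assms
proof (induction rule: finite_ne_induct)
  case (insert a A)
  then obtain w where w: "w \<in> A" "A \<subseteq> atmost w" by blast
  show ?case
  proof (cases "lt w a")
    case True
    then show ?thesis using w lt_trans by blast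
  next
    case False
    then show ?thesis using w lt_total[of a w] by blast
  qed
qed simp

lemma lm_spec:
  assumes "p \<noteq> 0"
  shows "lm lt p \<in> keys p \<and> keys p \<subseteq> atmost (lm lt p)"
proof -
  obtain w where "w \<in> keys p" "keys p \<subseteq> atmost w"
    using finite_max[of "keys p"] assms by auto
  then show ?thesis using lm_eqI by metis
qed

lemma lm_in_keys: "p \<noteq> 0 \<Longrightarrow> lm lt p \<in> keys p"
  and keys_atmost_lm: "p \<noteq> 0 \<Longrightarrow> keys p \<subseteq> atmost (lm lt p)"
  using lm_spec by auto

lemma lc_nonzero: "p \<noteq> 0 \<Longrightarrow> lc lt p \<noteq> 0"
  using lm_in_keys by (auto simp: lc_def in_keys_iff)

lemma keys_multiple_atmost:
  assumes "g \<noteq> 0"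
  shows "keys (multiple c u g v) \<subseteq> atmost (u + lm lt g + v)"
  using keys_term_mult_term[where p = g and c = c and u = u and v = v and d = 1]
    keys_atmost_lm[OF assms] lt_mult by blast

lemma lookup_multiple_lm: "lookup (multiple c u g v) (u + lm lt g + v) = c * lc lt g"
  by (simp add: lookup_term_mult_term lc_def)

lemma keys_diff_below:
  fixes p q :: "('x, 'k::field) ncpoly"
  assumes "keys p \<subseteq> atmost w" "keys q \<subseteq> atmost w" "lookup p w = lookup q w"
  shows "keys (p - q) \<subseteq> below w"
proof
  fix k assume k: "k \<in> keys (p - q)"
  then have "k \<noteq> w" using assms(3) by (auto simp: in_keys_iff lookup_minus)
  then show "k \<in> below w" using k keys_diff[of p q] assms(1,2) by auto
qed

text \<open>Subtracting multiples with leading word in such a set keeps the support inside it.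
  Initial segments of the ordering and sets of bounded \<theta>-value are both treated this
  way.\<close>

definition downset :: "'x list set \<Rightarrow> bool" where
  "downset S \<longleftrightarrow> (\<forall>w\<in>S. atmost w \<subseteq> S)"

lemma downset_below: "downset (below w)" and downset_atmost: "downset (atmost w)"
  using lt_trans by (auto simp: downset_def)

lemma spanned_keys:
  assumes "p \<in> spanned lt G S" "downset S"
  shows "keys p \<subseteq> S"
  using assms(1)
proof (induction rule: spanned.induct)
  case (step g u v q c)
  then show ?case
    using keys_add[of "multiple c u g v" q] keys_multiple_atmost[where g = g and c = c and u = u and v = v] assms(2)
    unfolding downset_def by blast
qed simp

text \<open>A step cancels a word of the current support, so the leading word of the subtracted
  multiple lies in \<open>S\<close>; down-closure puts the new polynomial back into
  \<open>S\<close>.\<close>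

lemma division_spanned:
  assumes "division lt G p Q r" "keys p \<subseteq> S" "downset S"
  shows "p - r \<in> spanned lt G S"
  using assms(1,2)
proof (induction rule: division.induct)
  case (division_stop p)
  then show ?case by (simp add: spanned.zero)
next
  case (division_step g c p u v Q r)
  let ?m = "multiple (c / lc lt g) u g v"
  have w: "u + lm lt g + v \<in> S"
    using division_step by (auto simp: in_keys_iff)
  then have "keys (p - ?m) \<subseteq> S"
    using keys_diff[of p ?m] keys_multiple_atmost[where g = g and c = "c / lc lt g" and u = u and v = v] assms(3) division_step
    unfolding downset_def by blast
  then have "p - ?m - r \<in> spanned lt G S" by (rule division_step.IH)
  then have "?m + (p - ?m - r) \<in> spanned lt G S"
    using division_step w by (intro spanned.step)
  then show ?case by (simp add: algebra_simps)
qed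

text \<open>Cancelling the leading term stays in \<open>J\<close> and lowers the leading monomial,
  so well-foundedness ends the process, and it can end only at zero.\<close>

lemma lead_divisible_division:
  assumes div: "lead_divisible lt G J" and GJ: "G \<subseteq> J" and J: "two_sided_ideal J" and "p \<in> J"
  shows "\<exists>Q. division lt G p Q 0"
proof (cases "p = 0")
  case True
  then show ?thesis using division_stop by blast
next
  case False
  have "\<forall>p\<in>J. p \<noteq> 0 \<longrightarrow> lm lt p = w \<longrightarrow> (\<exists>Q. division lt G p Q 0)" for w
  proof (induction w rule: wfp_induct_rule[OF wfp_lt])
    case (1 w)
    show ?case
    proof (intro ballI impI)
      fix p assume p: "p \<in> J" "p \<noteq> 0" "lm lt p = w"
      obtain g u v where g: "g \<in> G" "g \<noteq> 0" "w = u + lm lt g + v"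
        using div p unfolding lead_divisible_def by blast
      define c where "c = lookup p w"
      let ?q = "p - multiple (c / lc lt g) u g v"
      have q: "?q \<in> J"
        using p g GJ by (intro two_sided_ideal_diff[OF J] two_sided_ideal_mult[OF J]) auto
      have "keys ?q \<subseteq> below w"
        using p g keys_atmost_lm[OF p(2)] keys_multiple_atmost[OF g(2)] lc_nonzero[OF g(2)]
        by (intro keys_diff_below) (simp_all add: lookup_multiple_lm c_def)
      then have "lt (lm lt ?q) w" if "?q \<noteq> 0"
        using lm_in_keys[OF that] by blast
      then have "\<exists>Q. division lt G ?q Q 0"
        using 1 q division_stop[of lt G 0] by (cases "?q = 0") auto
      then obtain Q where "division lt G ?q Q 0" ..
      moreover have "c \<noteq> 0" using lm_in_keys[OF p(2)] p(3) by (simp add: c_def in_keys_iff)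
      ultimately show "\<exists>Q. division lt G p Q 0"
        using division_step[of g G c p u lt v Q 0] g c_def by blast
    qed
  qed
  then show ?thesis using assms False by blast
qed

text \<open>S-polynomials of members of \<open>J\<close> lie in \<open>J\<close> and hence divide to
  zero; the same division shows that \<open>G\<close> generates \<open>J\<close>.\<close>

lemma groebner_basisI:
  assumes div: "lead_divisible lt G J" and GJ: "G \<subseteq> J" and J: "two_sided_ideal J"
  shows "groebner_basis lt G J"
proof -
  have "J \<subseteq> two_sided_ideal hull G"
  proof
    fix p assume "p \<in> J"
    then obtain Q where "division lt G p Q 0"
      using lead_divisible_division assms by blast
    then show "p \<in> two_sided_ideal hull G"
      using division_diff_mem[OF _ hull_subset two_sided_ideal_hull] by fastforce
  qed
  moreover have "two_sided_ideal hull G \<subseteq> J" using GJ J by (rule hull_minimal)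
  moreover have "\<exists>Q. division lt G (spoly lt l1 p1 r1 l2 p2 r2) Q 0"
    if "p1 \<in> G" "p2 \<in> G" for p1 p2 l1 r1 l2 r2
    unfolding spoly_def using that GJ
    by (intro lead_divisible_division[OF assms] two_sided_ideal_diff[OF J] two_sided_ideal_mult[OF J]) auto
  ultimately show ?thesis unfolding groebner_basis_def by blast
qed

text \<open>A sum has finitely many summands, and by totality one of their leading words is
  greatest.\<close>

lemma spanned_bounded:
  assumes "p \<in> spanned lt G S"
  shows "p = 0 \<or> (\<exists>w\<in>S. p \<in> spanned lt G (atmost w))"
  using assms
proof (induction rule: spanned.induct)
  case (step g u v q c)
  let ?w = "u + lm lt g + v"
  have *: ?case if "w \<in> S" "?w \<in> atmost w" "q \<in> spanned lt G (atmost w)" for w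
    using that step spanned.step[of g G u lt v "atmost w" q c] by blast
  show ?case
  proof (cases "q \<in> spanned lt G (atmost ?w)")
    case True
    then show ?thesis using * step by blast
  next
    case False
    then obtain w where w: "w \<in> S" "q \<in> spanned lt G (atmost w)"
      using step.IH spanned.zero by blast
    have "?w \<in> atmost w"
    proof (rule ccontr)
      assume "?w \<notin> atmost w"
      then have "atmost w \<subseteq> atmost ?w"
        using lt_total[of w ?w] lt_trans by blast
      then show False using w(2) False spanned_mono by blast
    qed
    then show ?thesis using * w by blast
  qed
qed simp

text \<open>
  With \<open>p1 = a m1 + p1'\<close> and \<open>p2 = b m2 + p2'\<close> the difference equals
  \<open>u1 p1' t p2 v2 - u1 p1 t p2' v2\<close>.
\<close>

lemma disjoint_difference_spanned:
  fixes p1 p2 :: "('x, 'k::field) ncpoly"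
  assumes G: "p1 \<in> G" "p2 \<in> G" "p1 \<noteq> 0" "p2 \<noteq> 0"
    and w: "w = u1 + lm lt p1 + t + lm lt p2 + v2"
  shows "multiple (lc lt p2) u1 p1 (t + lm lt p2 + v2) - multiple (lc lt p1) (u1 + lm lt p1 + t) p2 v2
    \<in> spanned lt G (below w)"
proof -
  define q1 where "q1 = p1 - term_of (lc lt p1) (lm lt p1)"
  define q2 where "q2 = p2 - term_of (lc lt p2) (lm lt p2)"
  let ?X = "term_of 1 u1 :: ('x, 'k) ncpoly"
  let ?T = "term_of 1 t :: ('x, 'k) ncpoly"
  let ?Y = "term_of 1 v2 :: ('x, 'k) ncpoly"
  have q1: "keys q1 \<subseteq> below (lm lt p1)"
    unfolding q1_def using keys_atmost_lm[OF G(3)] by (intro keys_diff_below) (simp_all add: lc_def)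
  have q2: "keys q2 \<subseteq> below (lm lt p2)"
    unfolding q2_def using keys_atmost_lm[OF G(4)] by (intro keys_diff_below) (simp_all add: lc_def)
  have "multiple (lc lt p2) u1 p1 (t + lm lt p2 + v2)
      = ?X * p1 * (?T * term_of (lc lt p2) (lm lt p2) * ?Y)"
    by (simp only: mult_single mult_1_left mult_1_right
        term_mult_term_eq_multiple[where c = 1 and d = "lc lt p2"])
  moreover have "multiple (lc lt p1) (u1 + lm lt p1 + t) p2 v2
      = ?X * term_of (lc lt p1) (lm lt p1) * ?T * p2 * ?Y"
    by (simp only: mult_single mult_1_left mult_1_right)
  ultimately have eq: "multiple (lc lt p2) u1 p1 (t + lm lt p2 + v2)
      - multiple (lc lt p1) (u1 + lm lt p1 + t) p2 v2
      = ?X * q1 * (?T * p2 * ?Y) - ?X * p1 * ?T * q2 * ?Y"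
    by (simp add: q1_def q2_def algebra_simps)
  \<comment> \<open>Expanding the tail \<open>q1\<close> leaves multiples of \<open>p2\<close>.
    Their leading words arise from \<open>w\<close> by replacing \<open>lm lt p1\<close> with a
    smaller word.\<close>
  have "?X * q1 * (?T * p2 * ?Y)
      = ?X * (\<Sum>m\<in>keys q1. term_of (lookup q1 m) m) * (?T * p2 * ?Y)"
    by (simp only: sum_terms_eq)
  also have "\<dots> = (\<Sum>m\<in>keys q1. ?X * term_of (lookup q1 m) m * ?T * p2 * ?Y)"
    by (simp only: sum_distrib_left sum_distrib_right mult.assoc)
  also have "\<dots> = (\<Sum>m\<in>keys q1. multiple (lookup q1 m) (u1 + m + t) p2 v2)"
    by (simp only: mult_single mult_1_left mult_1_right)
  also have "\<dots> \<in> spanned lt G (below w)"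
  proof (intro spanned_sum spanned_multiple G)
    fix m assume "m \<in> keys q1"
    then have "lt (u1 + m + (t + lm lt p2 + v2)) (u1 + lm lt p1 + (t + lm lt p2 + v2))"
      using q1 by (intro lt_mult) blast
    then show "u1 + m + t + lm lt p2 + v2 \<in> below w"
      by (simp add: w add.assoc)
  qed
  finally have 1: "?X * q1 * (?T * p2 * ?Y) \<in> spanned lt G (below w)" .
  have "?X * p1 * ?T * q2 * ?Y
      = ?X * p1 * ?T * (\<Sum>m\<in>keys q2. term_of (lookup q2 m) m) * ?Y"
    by (simp only: sum_terms_eq)
  also have "\<dots> = (\<Sum>m\<in>keys q2. ?X * p1 * (?T * term_of (lookup q2 m) m * ?Y))"
    by (simp only: sum_distrib_left sum_distrib_right mult.assoc)
  also have "\<dots> = (\<Sum>m\<in>keys q2. multiple (lookup q2 m) u1 p1 (t + m + v2))"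
    by (simp only: mult_single mult_1_left mult_1_right
        term_mult_term_eq_multiple[where c = 1 and d = "lookup q2 _"])
  also have "\<dots> \<in> spanned lt G (below w)"
  proof (intro spanned_sum spanned_multiple G)
    fix m assume "m \<in> keys q2"
    then have "lt (u1 + lm lt p1 + t + m + v2) (u1 + lm lt p1 + t + lm lt p2 + v2)"
      using q2 by (intro lt_mult) blast
    then show "u1 + lm lt p1 + (t + m + v2) \<in> below w"
      by (simp add: w add.assoc)
  qed
  finally have 2: "?X * p1 * ?T * q2 * ?Y \<in> spanned lt G (below w)" .
  show ?thesis unfolding eq using 1 2 by (rule spanned_diff)
qed

lemma spoly_below:
  assumes "p1 \<noteq> 0" "p2 \<noteq> 0" "overlap l1 (lm lt p1) r1 l2 (lm lt p2) r2"
  shows "keys (spoly lt l1 p1 r1 l2 p2 r2) \<subseteq> below (l1 + lm lt p1 + r1)"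
proof -
  have eq: "l1 + lm lt p1 + r1 = l2 + lm lt p2 + r2"
    using assms(3) by (simp add: overlap_def)
  show ?thesis
    unfolding spoly_def
  proof (rule keys_diff_below)
    show "keys (multiple (lc lt p2) l1 p1 r1) \<subseteq> atmost (l1 + lm lt p1 + r1)"
      by (rule keys_multiple_atmost[OF assms(1)])
    show "keys (multiple (lc lt p1) l2 p2 r2) \<subseteq> atmost (l1 + lm lt p1 + r1)"
      unfolding eq by (rule keys_multiple_atmost[OF assms(2)])
    show "lookup (multiple (lc lt p2) l1 p1 r1) (l1 + lm lt p1 + r1)
        = lookup (multiple (lc lt p1) l2 p2 r2) (l1 + lm lt p1 + r1)"
      by (simp add: lookup_multiple_lm) (simp add: eq lookup_multiple_lm mult.commute)
  qed
qed

text \<open>The confluence step of the diamond lemma. Disjoint occurrences resolve by themselves;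
  for overlapping ones the difference is \<open>u * s * v\<close> for an S-polynomial
  \<open>s\<close> that divides to zero.\<close>

lemma common_lead_difference_spanned:
  fixes p1 p2 :: "('x, 'k::field) ncpoly"
  assumes gb: "groebner_basis lt G J"
    and G: "p1 \<in> G" "p2 \<in> G" "p1 \<noteq> 0" "p2 \<noteq> 0"
    and w: "w = u1 + lm lt p1 + v1" "w = u2 + lm lt p2 + v2"
  shows "multiple (lc lt p2) u1 p1 v1 - multiple (lc lt p1) u2 p2 v2 \<in> spanned lt G (below w)"
proof -
  have *: "multiple (lc lt p2) u1 p1 v1 - multiple (lc lt p1) u2 p2 v2 \<in> spanned lt G (below w)"
    if G: "p1 \<in> G" "p2 \<in> G" "p1 \<noteq> 0" "p2 \<noteq> 0"
      and w: "w = u1 + lm lt p1 + v1" "w = u2 + lm lt p2 + v2"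
      and len: "length u1 \<le> length u2" for p1 p2 u1 v1 u2 v2
    using trans[OF w(1)[symmetric] w(2)] len
  proof (cases rule: overlap_cases)
    case (disjoint t)
    then show ?thesis
      using disjoint_difference_spanned[OF G, of w u1 t v2] w by (simp add: add.assoc)
  next
    case (overlap u v l1 r1 l2 r2)
    let ?s = "spoly lt l1 p1 r1 l2 p2 r2"
    obtain Q where "division lt G ?s Q 0"
      using gb G overlap(1) unfolding groebner_basis_def by blast
    then have "?s \<in> spanned lt G (below (l1 + lm lt p1 + r1))"
      using division_spanned[OF _ spoly_below downset_below] G overlap(1) by fastforce
    then have "multiple 1 u ?s v \<in> spanned lt G (below w)"
    proof (rule spanned_term_mult)
      fix m assume "m \<in> below (l1 + lm lt p1 + r1)"
      then show "u + m + v \<in> below w"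
        using lt_mult[of m "l1 + lm lt p1 + r1" u v] w(1) overlap by (simp add: add.assoc)
    qed
    moreover have "multiple 1 u ?s v = multiple (lc lt p2) u1 p1 v1 - multiple (lc lt p1) u2 p2 v2"
      unfolding spoly_def overlap
      by (simp only: right_diff_distrib left_diff_distrib term_mult_multiple mult_1_left mult_1_right)
    ultimately show ?thesis by simp
  qed
  show ?thesis
  proof (cases "length u1 \<le> length u2")
    case True
    then show ?thesis using * G w by blast
  next
    case False
    \<comment> \<open>If the second occurrence starts first, the two roles are exchanged and the
      sign is corrected afterwards.\<close>
    then have "multiple (lc lt p1) u2 p2 v2 - multiple (lc lt p2) u1 p1 v1 \<in> spanned lt G (below w)"
      using *[OF G(2,1,4,3) w(2,1)] by simp
    from spanned_uminus[OF this] show ?thesis by simp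
  qed
qed

text \<open>All summands with leading word exactly \<open>w\<close> can be merged into one, since
  any two of them are proportional modulo the span below \<open>w\<close>.\<close>

lemma spanned_atmost_cases:
  fixes p :: "('x, 'k::field) ncpoly"
  assumes gb: "groebner_basis lt G J" and "p \<in> spanned lt G (atmost w)"
  shows "p \<in> spanned lt G (below w) \<or>
    (\<exists>g\<in>G. \<exists>u v c. \<exists>q\<in>spanned lt G (below w). g \<noteq> 0 \<and> u + lm lt g + v = w \<and> p = multiple c u g v + q)"
    (is "_ \<or> ?top p")
  using assms(2)
proof (induction rule: spanned.induct)
  case zero
  then show ?case by (simp add: spanned.zero)
next
  case (step g u v p c)
  show ?case
  proof (cases "u + lm lt g + v = w")
    case False
    then have m: "multiple c u g v \<in> spanned lt G (below w)"
      using step by (intro spanned_multiple) auto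
    from step.IH show ?thesis
    proof
      assume "?top p"
      then obtain g' u' v' c' q where g': "g' \<in> G" "g' \<noteq> 0" "u' + lm lt g' + v' = w"
        "q \<in> spanned lt G (below w)" "p = multiple c' u' g' v' + q"
        by blast
      have "multiple c u g v + p = multiple c' u' g' v' + (multiple c u g v + q)"
        using g'(5) by (simp add: add_ac)
      then show ?thesis using g' spanned_add[OF m g'(4)] by blast
    qed (use m spanned_add in blast)
  next
    case True
    from step.IH show ?thesis
    proof
      assume "?top p"
      then obtain g' u' v' c' q where g': "g' \<in> G" "g' \<noteq> 0" "u' + lm lt g' + v' = w"
        "q \<in> spanned lt G (below w)" "p = multiple c' u' g' v' + q"
        by blast
      \<comment> \<open>Scaled so that \<open>multiple c u g v\<close> becomes \<open>d\<close> plus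
        a multiple of \<open>u' g' v'\<close>, which is then absorbed into the existing top
        summand.\<close>
      define d where "d = term_of (c / lc lt g') 0 * (multiple (lc lt g') u g v - multiple (lc lt g) u' g' v')"
      have d: "d \<in> spanned lt G (below w)"
        unfolding d_def using gb step g' True
        by (intro spanned_scale common_lead_difference_spanned) auto
      have scale: "term_of a 0 * multiple b u g v = multiple (a * b) u g v" for a b u v and g :: "('x, 'k) ncpoly"
        using term_mult_multiple[where c = a and u = 0 and a = b and u' = u and g = g and v' = v and d = 1 and v = 0]
        by simp
      have "d = multiple c u g v - multiple (c / lc lt g' * lc lt g) u' g' v'"
        unfolding d_def right_diff_distrib scale using lc_nonzero[OF g'(2)] by simp
      then have "multiple c u g v + p = multiple (c / lc lt g' * lc lt g) u' g' v' + multiple c' u' g' v' + (d + q)"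
        using g'(5) by simp
      also have "\<dots> = multiple (c / lc lt g' * lc lt g + c') u' g' v' + (d + q)"
        by (simp add: single_add distrib_right)
      finally show ?thesis using g' spanned_add[OF d g'(4)] by blast
    qed (use step True in blast)
  qed
qed

text \<open>Induction on a bound \<open>w\<close> for the leading words in a representation. After
  merging, either one top multiple survives and determines the leading monomial, or a smaller bound
  exists.\<close>

lemma groebner_basis_lead_divisible:
  fixes G :: "('x, 'k::field) ncpoly set"
  assumes gb: "groebner_basis lt G J"
  shows "lead_divisible lt G J"
proof -
  have *: "\<forall>p\<in>spanned lt G (atmost w). p \<noteq> 0 \<longrightarrow> (\<exists>g\<in>G. \<exists>u v. g \<noteq> 0 \<and> lm lt p = u + lm lt g + v)" for w
  proof (induction w rule: wfp_induct_rule[OF wfp_lt])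
    case (1 w)
    have IH: "\<exists>g\<in>G. \<exists>u v. g \<noteq> 0 \<and> lm lt p = u + lm lt g + v"
      if p: "p \<in> spanned lt G (below w)" "p \<noteq> 0" for p
      using spanned_bounded[OF p(1)] p(2) 1 by blast
    show ?case
    proof (intro ballI impI)
      fix p assume p: "p \<in> spanned lt G (atmost w)" "p \<noteq> 0"
      from spanned_atmost_cases[OF gb p(1)] show "\<exists>g\<in>G. \<exists>u v. g \<noteq> 0 \<and> lm lt p = u + lm lt g + v"
      proof (elim disjE bexE exE conjE)
        fix g u v c q
        assume q: "q \<in> spanned lt G (below w)" "p = multiple c u g v + q"
          and g: "g \<in> G" "g \<noteq> 0" "u + lm lt g + v = w"
        show ?thesis
        proof (cases "c = 0")
          case True
          then show ?thesis using IH p q by simp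
        next
          case False
          \<comment> \<open>Nothing can cancel the top multiple at \<open>w\<close>, because the
            remaining summands are supported below \<open>w\<close>.\<close>
          have "lookup q w = 0"
            using spanned_keys[OF q(1) downset_below] lt_irrefl by (auto simp: in_keys_iff)
          then have "w \<in> keys p"
            using q(2) g lookup_multiple_lm[where g = g and c = c and u = u and v = v] lc_nonzero[OF g(2)] False
            by (simp add: in_keys_iff lookup_add)
          then have "lm lt p = w"
            using spanned_keys[OF p(1) downset_atmost] by (rule lm_eqI)
          then show ?thesis using g by metis
        qed
      qed (use IH p in blast)
    qed
  qed
  show ?thesis
    unfolding lead_divisible_def
  proof (intro ballI impI)
    fix p assume "p \<in> J" "p \<noteq> 0"
    moreover have "J \<subseteq> spanned lt G UNIV"
      using gb hull_subset_spanned unfolding groebner_basis_def by blast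
    ultimately obtain w where "p \<in> spanned lt G (atmost w)"
      using spanned_bounded by blast
    then show "\<exists>g\<in>G. \<exists>u v. g \<noteq> 0 \<and> lm lt p = u + lm lt g + v"
      using * \<open>p \<noteq> 0\<close> by blast
  qed
qed

end

section \<open>The grading by an ordering function\<close>

lemma lookup_initial:
  "lookup (initial \<theta> p) m = (if m \<in> keys p \<and> (\<forall>m'\<in>keys p. \<theta> m' \<le> \<theta> m) then lookup p m else 0)"
proof -
  let ?A = "{m \<in> keys p. \<forall>m'\<in>keys p. \<theta> m' \<le> \<theta> m}"
  have "lookup (initial \<theta> p) m = (\<Sum>k\<in>?A. if k = m then lookup p k else 0)"
    by (simp add: initial_def lookup_sum lookup_single when_def)
  also have "\<dots> = (if m \<in> ?A then lookup p m else 0)"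
    by (subst sum.delta) auto
  finally show ?thesis by simp
qed

lemma keys_initial: "keys (initial \<theta> p) = {m \<in> keys p. \<forall>m'\<in>keys p. \<theta> m' \<le> \<theta> m}"
  by (auto simp: in_keys_iff lookup_initial split: if_splits)

lemma initial_zero [simp]: "initial \<theta> 0 = 0"
  by (simp add: initial_def)

lemma homogeneous_iff: "homogeneous \<theta> p \<longleftrightarrow> (\<forall>m\<in>keys p. \<forall>m'\<in>keys p. \<theta> m = \<theta> m')"
proof
  assume "homogeneous \<theta> p"
  then have "keys p = keys (initial \<theta> p)"
    unfolding homogeneous_def by (rule arg_cong)
  then have "\<theta> m' \<le> \<theta> m" if "m \<in> keys p" "m' \<in> keys p" for m m'
    using that unfolding keys_initial by blast
  then show "\<forall>m\<in>keys p. \<forall>m'\<in>keys p. \<theta> m = \<theta> m'" by (blast intro: antisym)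
next
  assume eq: "\<forall>m\<in>keys p. \<forall>m'\<in>keys p. \<theta> m = \<theta> m'"
  have "lookup p m = lookup (initial \<theta> p) m" for m
  proof (cases "m \<in> keys p")
    case True
    then have "\<forall>m'\<in>keys p. \<theta> m' \<le> \<theta> m" using eq by (metis order_refl)
    then show ?thesis using True by (simp add: lookup_initial)
  next
    case False
    then show ?thesis by (simp add: lookup_initial in_keys_iff)
  qed
  then show "homogeneous \<theta> p"
    unfolding homogeneous_def by (rule poly_mapping_eqI)
qed

text \<open>For distinct words the binomial \<open>m1 + m2\<close> is a homogeneous test polynomial,
  and extendibility is applied to its multiple by \<open>u\<close> and \<open>v\<close>.\<close>

lemma extendible_mult_eq:
  assumes "extendible TYPE('k::field) \<theta>" "\<theta> m1 = \<theta> m2"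
  shows "\<theta> (u + m1 + v) = \<theta> (u + m2 + v)"
proof (cases "m1 = m2")
  case False
  let ?p = "term_of 1 m1 + term_of 1 m2 :: ('a, 'k) ncpoly"
  have p: "keys ?p = {m1, m2}"
    using False by (auto simp: in_keys_iff lookup_add lookup_single when_def split: if_splits)
  then have "homogeneous \<theta> ?p"
    using assms(2) by (auto simp: homogeneous_iff)
  then have "homogeneous \<theta> (multiple 1 u ?p v)"
    using assms(1) unfolding extendible_def by simp
  moreover have "keys (multiple 1 u ?p v) = {u + m1 + v, u + m2 + v}"
    using keys_term_mult_term_nz[where p = ?p and c = 1 and d = 1 and u = u and v = v] p by simp
  ultimately show ?thesis unfolding homogeneous_iff by blast
qed simp

text \<open>Unlike \<open>initial\<close>, this is additive, so the part of a fixed \<theta>-value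
  can be followed through a sum of multiples.\<close>

definition component :: "('x list \<Rightarrow> int) \<Rightarrow> int \<Rightarrow> ('x, 'k::zero) ncpoly \<Rightarrow> ('x, 'k) ncpoly" where
  "component \<theta> d p = Poly_Mapping.mapp (\<lambda>m c. c when \<theta> m = d) p"

lemma lookup_component: "lookup (component \<theta> d p) m = (lookup p m when \<theta> m = d)"
  by (auto simp: component_def lookup_mapp when_def in_keys_iff)

lemma component_zero [simp]: "component \<theta> d 0 = 0"
  by (rule poly_mapping_eqI) (simp add: lookup_component)

lemma component_add: "component \<theta> d (p + q) = component \<theta> d p + component \<theta> d q"
  by (rule poly_mapping_eqI) (simp add: lookup_component lookup_add when_def)

lemma component_eq_self: "keys p \<subseteq> {m. \<theta> m = d} \<Longrightarrow> component \<theta> d p = p"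
  by (rule poly_mapping_eqI) (auto simp: lookup_component when_def in_keys_iff)

lemma component_eq_zero: "keys p \<inter> {m. \<theta> m = d} = {} \<Longrightarrow> component \<theta> d p = 0"
  by (rule poly_mapping_eqI) (auto simp: lookup_component when_def in_keys_iff)

lemma initial_eq_component:
  assumes "keys p \<subseteq> {m. \<theta> m \<le> d}" "m0 \<in> keys p" "\<theta> m0 = d"
  shows "initial \<theta> p = component \<theta> d p"
proof (rule poly_mapping_eqI)
  fix k
  show "lookup (initial \<theta> p) k = lookup (component \<theta> d p) k"
    using assms by (cases "k \<in> keys p") (force simp: lookup_initial lookup_component when_def in_keys_iff)+
qed

text \<open>With a common value \<open>d\<close> for all recorded multiples, no cancellation among
  higher terms is hidden in the sum. The condition restricts the words \<open>u\<close>,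
  \<open>v\<close>; the coefficients \<open>a\<close>, \<open>b\<close> may vanish.\<close>

definition graded_log :: "('x list \<Rightarrow> int) \<Rightarrow> ('x, 'k::field) ncpoly set \<Rightarrow> int \<Rightarrow> ('x, 'k) log \<Rightarrow> bool" where
  "graded_log \<theta> P d L \<longleftrightarrow> (\<forall>(l, g, r)\<in>set L. g \<in> P \<and> g \<noteq> 0 \<and>
     (\<exists>a u b v. l = term_of a u \<and> r = term_of b v \<and> (\<forall>m\<in>keys g. \<theta> (u + m + v) = d)))"

lemma graded_log_Nil [simp]: "graded_log \<theta> P d []"
  by (simp add: graded_log_def)

lemma graded_log_Cons:
  "graded_log \<theta> P d ((l, g, r) # L) \<longleftrightarrow> (g \<in> P \<and> g \<noteq> 0 \<and>
     (\<exists>a u b v. l = term_of a u \<and> r = term_of b v \<and> (\<forall>m\<in>keys g. \<theta> (u + m + v) = d)))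
     \<and> graded_log \<theta> P d L"
  by (simp add: graded_log_def)

lemma graded_log_self:
  fixes p :: "('x, 'k::field) ncpoly"
  assumes "p \<in> P" "p \<noteq> 0" "keys p \<subseteq> {m. \<theta> m = d}"
  shows "graded_log \<theta> P d [(1, p, 1)]"
proof -
  have "graded_log \<theta> P d [(term_of 1 0, p, term_of 1 0)]"
    unfolding graded_log_Cons using assms by fastforce
  then show ?thesis by simp
qed

lemma graded_log_append [simp]:
  "graded_log \<theta> P d (L @ M) \<longleftrightarrow> graded_log \<theta> P d L \<and> graded_log \<theta> P d M"
  by (simp add: graded_log_def ball_Un)

lemma graded_log_mono: "graded_log \<theta> P d L \<Longrightarrow> P \<subseteq> P' \<Longrightarrow> graded_log \<theta> P' d L"
  by (fastforce simp: graded_log_def)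

lemma graded_log_mult:
  assumes "graded_log \<theta> P e L" and "\<And>m. \<theta> m = e \<Longrightarrow> \<theta> (u + m + v) = d"
  shows "graded_log \<theta> P d (log_mult (term_of a u) L (term_of b v))"
  using assms(1)
proof (induction L)
  case (Cons x L)
  obtain l g r where x: "x = (l, g, r)" by (cases x)
  then obtain a' u' b' v' where g: "g \<in> P" "g \<noteq> 0" "l = term_of a' u'" "r = term_of b' v'"
    "\<forall>m\<in>keys g. \<theta> (u' + m + v') = e"
    using Cons.prems unfolding x graded_log_Cons by blast
  have "\<forall>m\<in>keys g. \<theta> ((u + u') + m + (v' + v)) = d"
    using g(5) assms(2) by (metis add.assoc)
  then have "g \<in> P \<and> g \<noteq> 0 \<and> (\<exists>a'' u'' b'' v''. term_of a u * l = term_of a'' u''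
      \<and> r * term_of b v = term_of b'' v'' \<and> (\<forall>m\<in>keys g. \<theta> (u'' + m + v'') = d))"
    unfolding g(3,4) mult_single using g(1,2) by blast
  moreover have "graded_log \<theta> P d (log_mult (term_of a u) L (term_of b v))"
    using Cons x by (simp add: graded_log_Cons)
  ultimately show ?case
    by (simp add: x log_mult_def graded_log_Cons)
qed (simp add: log_mult_def)

section \<open>Values of logs and stability under multiplication\<close>

lemma log_sum_Nil [simp]: "log_sum [] = 0"
  and log_sum_Cons: "log_sum ((l, g, r) # L) = l * g * r + log_sum L"
  and log_sum_append: "log_sum (L @ M) = log_sum L + log_sum M"
  by (simp_all add: log_sum_def)

lemma log_sum_mult: "log_sum (log_mult a L b) = a * log_sum L * b"
proof (induction L)
  case (Cons x L)
  then show ?case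
    by (cases x) (simp add: log_mult_def log_sum_Cons algebra_simps)
qed (simp add: log_mult_def)

lemma log_mult_minus_one: "log_mult (- 1) L 1 = log_mult (term_of (- 1) 0) L (term_of 1 0)"
  by (simp add: single_uminus)

text \<open>No additivity of \<theta> is assumed: for fixed \<open>u\<close>, \<open>v\<close> the
  value of \<open>u + m + v\<close> depends on that of \<open>m\<close> alone, and strictly
  monotonically.\<close>

locale grading =
  fixes \<theta> :: "'x::finite list \<Rightarrow> int"
  assumes mult_less: "\<theta> m1 < \<theta> m2 \<Longrightarrow> \<theta> (u + m1 + v) < \<theta> (u + m2 + v)"
    and mult_eq: "\<theta> m1 = \<theta> m2 \<Longrightarrow> \<theta> (u + m1 + v) = \<theta> (u + m2 + v)"
begin

lemma mult_le: "\<theta> m1 \<le> \<theta> m2 \<Longrightarrow> \<theta> (u + m1 + v) \<le> \<theta> (u + m2 + v)"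
  using mult_less mult_eq by (metis le_less)

abbreviation "degree_eq d \<equiv> {m. \<theta> m = d}"
abbreviation "degree_le d \<equiv> {m. \<theta> m \<le> d}"

lemma initial_keys_degree: "\<exists>d. keys (initial \<theta> p) \<subseteq> degree_eq d"
proof (cases "keys (initial \<theta> p) = {}")
  case False
  then obtain m where "m \<in> keys (initial \<theta> p)" by blast
  then show ?thesis by (intro exI[of _ "\<theta> m"]) (auto simp: keys_initial antisym)
qed auto

lemma initial_nonzero: "p \<noteq> 0 \<Longrightarrow> initial \<theta> p \<noteq> 0"
proof -
  assume "p \<noteq> 0"
  then have "finite (\<theta> ` keys p)" "\<theta> ` keys p \<noteq> {}" by auto
  then obtain m where "m \<in> keys p" "\<theta> m = Max (\<theta> ` keys p)"
    using Max_in[of "\<theta> ` keys p"] by (metis imageE)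
  then have "m \<in> keys (initial \<theta> p)"
    using \<open>finite (\<theta> ` keys p)\<close> by (auto simp: keys_initial)
  then show ?thesis by auto
qed

text \<open>Monomials of the initial land exactly on value \<open>d\<close>, and strictness pushes
  all others below it, so forming the initial commutes with term multiples.\<close>

lemma multiple_initial:
  fixes g :: "('x, 'k::field) ncpoly"
  assumes "g \<noteq> 0" and d: "\<forall>m\<in>keys (initial \<theta> g). \<theta> (u + m + v) = d"
  shows "keys (multiple c u g v) \<subseteq> degree_le d"
    and "component \<theta> d (multiple c u g v) = multiple c u (initial \<theta> g) v"
proof -
  obtain m0 where m0: "m0 \<in> keys (initial \<theta> g)"
    using initial_nonzero[OF assms(1)] by (meson all_not_in_conv keys_eq_empty)
  then have max: "\<theta> m \<le> \<theta> m0" if "m \<in> keys g" for m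
    using that by (auto simp: keys_initial)
  then have "\<theta> (u + m + v) \<le> d" if "m \<in> keys g" for m
    using mult_le[of m m0 u v] that d m0 by auto
  then show "keys (multiple c u g v) \<subseteq> degree_le d"
    using keys_term_mult_term[where p = g and c = c and u = u and v = v and d = 1] by blast
  have less: "\<theta> (u + m + v) < d" if "m \<in> keys g" "m \<notin> keys (initial \<theta> g)" for m
  proof -
    have "\<theta> m < \<theta> m0"
      using that max m0 by (force simp: keys_initial)
    then show ?thesis using mult_less[of m m0 u v] d m0 by auto
  qed
  show "component \<theta> d (multiple c u g v) = multiple c u (initial \<theta> g) v"
  proof (rule poly_mapping_eqI)
    fix k
    show "lookup (component \<theta> d (multiple c u g v)) k = lookup (multiple c u (initial \<theta> g) v) k"
    proof (cases "k \<in> (\<lambda>m. u + m + v) ` keys g")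
      case True
      then obtain m where k: "k = u + m + v" "m \<in> keys g" by blast
      show ?thesis
      proof (cases "m \<in> keys (initial \<theta> g)")
        case True
        then have "lookup (initial \<theta> g) m = lookup g m"
          by (auto simp: lookup_initial keys_initial)
        then show ?thesis
          using True d by (simp add: k lookup_component lookup_term_mult_term)
      next
        case False
        then show ?thesis
          using less[OF k(2) False] by (simp add: k lookup_component lookup_term_mult_term in_keys_iff)
      qed
    next
      case False
      then have "k \<notin> keys (multiple c u g v)"
        using keys_term_mult_term[where p = g and c = c and u = u and v = v and d = 1] by blast
      moreover have "k \<notin> keys (multiple c u (initial \<theta> g) v)"
        using keys_term_mult_term[where p = "initial \<theta> g" and c = c and u = u and v = v and d = 1] False
        by (auto simp: keys_initial)
      ultimately show ?thesis by (simp add: lookup_component in_keys_iff)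
    qed
  qed
qed

lemma graded_log_keys:
  assumes "graded_log \<theta> P d L"
  shows "keys (log_sum L) \<subseteq> degree_eq d"
  using assms
proof (induction L)
  case (Cons x L)
  obtain l g r where x: "x = (l, g, r)" by (cases x)
  then obtain a u b v where g: "l = term_of a u" "r = term_of b v" "\<forall>m\<in>keys g. \<theta> (u + m + v) = d"
    using Cons.prems unfolding x graded_log_Cons by blast
  have "keys (l * g * r) \<subseteq> degree_eq d"
    unfolding g(1,2) using g(3) by (intro order_trans[OF keys_term_mult_term]) auto
  moreover have "keys (log_sum L) \<subseteq> degree_eq d"
    using Cons x by (simp add: graded_log_Cons)
  ultimately show ?case
    unfolding x log_sum_Cons by (intro order_trans[OF keys_add]) simp
qed simp

text \<open>Replacing each \<open>g'\<close> by \<open>g\<close> adds only terms of \<theta>-value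
  below \<open>d\<close>. As the original sum is nonzero of value \<open>d\<close>, it is the
  initial of the lift.\<close>

lemma lift_initial:
  assumes "graded_log \<theta> G' d L" and "lifts \<theta> G L h" and "log_sum L \<noteq> 0"
  shows "initial \<theta> h = log_sum L" and "h \<in> two_sided_ideal hull G"
proof -
  obtain M where rel: "list_all2 (\<lambda>(l, g', r) (l', g, r'). l' = l \<and> r' = r \<and> g \<in> G \<and> initial \<theta> g = g') L M"
    and h: "h = log_sum M"
    using assms(2) unfolding lifts_def by blast
  from rel assms(1) have "keys (log_sum M) \<subseteq> degree_le d \<and> component \<theta> d (log_sum M) = log_sum L
      \<and> log_sum M \<in> two_sided_ideal hull G"
  proof (induction rule: list_all2_induct)
    case Nil
    then show ?case by (simp add: zero_in_hull)
  next
    case (Cons x L y M)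
    obtain l g' r where x: "x = (l, g', r)" by (cases x)
    then obtain g where y: "y = (l, g, r)" "g \<in> G" "initial \<theta> g = g'"
      using Cons.hyps(1) by (cases y) auto
    obtain a u b v where g: "g' \<noteq> 0" "l = term_of a u" "r = term_of b v"
      "\<forall>m\<in>keys g'. \<theta> (u + m + v) = d"
      using Cons.prems unfolding x graded_log_Cons by blast
    have "g \<noteq> 0" using g(1) y(3) by auto
    then have lgr: "keys (l * g * r) \<subseteq> degree_le d" "component \<theta> d (l * g * r) = l * g' * r"
      unfolding g(2,3) term_mult_term_eq_multiple[where d = b]
      using multiple_initial[of g u v d] g(4) y(3) by auto
    have IH: "keys (log_sum M) \<subseteq> degree_le d" "component \<theta> d (log_sum M) = log_sum L"
      "log_sum M \<in> two_sided_ideal hull G"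
      using Cons x by (simp_all add: graded_log_Cons)
    have "keys (log_sum (y # M)) \<subseteq> degree_le d"
      unfolding y log_sum_Cons using lgr(1) IH(1) by (intro order_trans[OF keys_add]) simp
    moreover have "log_sum (y # M) \<in> two_sided_ideal hull G"
      unfolding y log_sum_Cons using y(2) IH(3)
      by (intro two_sided_ideal_add[OF two_sided_ideal_hull] two_sided_ideal_mult[OF two_sided_ideal_hull])
        (auto intro: hull_inc)
    ultimately show ?case
      by (simp add: x y(1) log_sum_Cons component_add lgr IH)
  qed
  then have *: "keys h \<subseteq> degree_le d" "component \<theta> d h = log_sum L" "h \<in> two_sided_ideal hull G"
    by (simp_all add: h)
  then obtain m0 where "m0 \<in> keys (component \<theta> d h)"
    using assms(3) by (metis all_not_in_conv keys_eq_empty)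
  then have "m0 \<in> keys h" "\<theta> m0 = d"
    by (auto simp: in_keys_iff lookup_component when_def split: if_splits)
  then show "initial \<theta> h = log_sum L"
    using initial_eq_component[OF *(1)] *(2) by simp
  show "h \<in> two_sided_ideal hull G" by (fact *)
qed

text \<open>The invariant of logged completion and interreduction. Zero is exempt because its
  starting log \<open>[(1, 0, 1)]\<close> has a zero entry, which \<open>graded_log\<close>
  forbids.\<close>

definition valid_state :: "('x, 'k::field) ncpoly set \<Rightarrow> ('x, 'k) logged_state \<Rightarrow> bool" where
  "valid_state G' = (\<lambda>(P, K). \<forall>p\<in>P. p \<noteq> 0 \<longrightarrow>
     (\<exists>e. keys p \<subseteq> degree_eq e \<and> graded_log \<theta> G' e (K p) \<and> log_sum (K p) = p))"

lemma valid_stateD: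
  assumes "valid_state G' (P, K)" "p \<in> P" "p \<noteq> 0"
  obtains e where "keys p \<subseteq> degree_eq e" "graded_log \<theta> G' e (K p)" "log_sum (K p) = p"
  using assms by (auto simp: valid_state_def)

lemma valid_state_keys: "valid_state G' (P, K) \<Longrightarrow> p \<in> P \<Longrightarrow> \<exists>e. keys p \<subseteq> degree_eq e"
  unfolding valid_state_def by (cases "p = 0") auto

lemma valid_state_update:
  assumes "valid_state G' (P, K)" "P' \<subseteq> P"
    and "keys r \<subseteq> degree_eq e" "graded_log \<theta> G' e L" "log_sum L = r"
  shows "valid_state G' (insert r P', K(r := L))"
  using assms unfolding valid_state_def by auto

lemma log_subst_valid:
  assumes K: "valid_state G' (P, K)" and "graded_log \<theta> P d Q"
  shows "graded_log \<theta> G' d (log_subst K Q) \<and> log_sum (log_subst K Q) = log_sum Q"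
  using assms(2)
proof (induction Q)
  case Nil
  then show ?case by (simp add: log_subst_def)
next
  case (Cons x Q)
  obtain l p r where x: "x = (l, p, r)" by (cases x)
  then obtain a u b v where p: "p \<in> P" "p \<noteq> 0" "l = term_of a u" "r = term_of b v"
    "\<forall>m\<in>keys p. \<theta> (u + m + v) = d"
    using Cons.prems unfolding x graded_log_Cons by blast
  obtain e where e: "keys p \<subseteq> degree_eq e" "graded_log \<theta> G' e (K p)" "log_sum (K p) = p"
    using valid_stateD[OF K p(1,2)] .
  obtain m0 where "m0 \<in> keys p" using p(2) by (meson all_not_in_conv keys_eq_empty)
  \<comment> \<open>One monomial of \<open>p\<close> fixes the value for every word of degree
    \<open>e\<close>, hence for all multiples recorded in \<open>K p\<close>.\<close>
  then have "\<theta> (u + m + v) = d" if "\<theta> m = e" for m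
    using mult_eq[of m m0 u v] that e(1) p(5) by auto
  then have "graded_log \<theta> G' d (log_mult l (K p) r)"
    unfolding p(3,4) by (rule graded_log_mult[OF e(2)])
  moreover have "log_subst K (x # Q) = log_mult l (K p) r @ log_subst K Q"
    by (simp add: log_subst_def x)
  ultimately show ?case
    using Cons by (simp add: x graded_log_Cons log_sum_append log_sum_Cons log_sum_mult e(3))
qed

end

text \<open>Monotonicity is only weak, since words of equal \<theta>-value are separated by the
  later functions of the decomposition.\<close>

locale graded_order = admissible lt + grading \<theta> 
  for lt :: "'x::finite list \<Rightarrow> 'x list \<Rightarrow> bool" and \<theta> :: "'x list \<Rightarrow> int" +
  assumes refines: "lt a b \<Longrightarrow> \<theta> a \<le> \<theta> b"
begin

section \<open>Initials and divisions under an ordering that refines the grading\<close>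

lemma downset_degree_le: "downset (degree_le d)"
  using refines by (fastforce simp: downset_def)

text \<open>All other monomials are smaller, so by refinement none has a larger \<theta>-value. Thus
  a polynomial and its initial share the leading monomial.\<close>

lemma lm_in_keys_initial: "p \<noteq> 0 \<Longrightarrow> lm lt p \<in> keys (initial \<theta> p)"
  using keys_atmost_lm[of p] lm_in_keys[of p] refines by (auto simp: keys_initial)

lemma lm_initial: "p \<noteq> 0 \<Longrightarrow> lm lt (initial \<theta> p) = lm lt p"
  using lm_in_keys_initial keys_atmost_lm by (intro lm_eqI) (auto simp: keys_initial)

lemma initial_eq_component_lm: "p \<noteq> 0 \<Longrightarrow> initial \<theta> p = component \<theta> (\<theta> (lm lt p)) p"
  using lm_in_keys_initial[of p] by (intro initial_eq_component) (auto simp: keys_initial)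

lemma component_multiple_mem:
  assumes "g \<in> G" "g \<noteq> 0" "\<theta> (u + lm lt g + v) \<le> d"
  shows "component \<theta> d (multiple c u g v) \<in> two_sided_ideal hull (initial \<theta> ` G)"
proof -
  let ?e = "\<theta> (u + lm lt g + v)"
  have "\<forall>m\<in>keys (initial \<theta> g). \<theta> (u + m + v) = ?e"
    using lm_in_keys_initial[OF assms(2)] by (auto simp: keys_initial intro!: mult_eq antisym)
  note * = multiple_initial[OF assms(2) this]
  show ?thesis
  proof (cases "?e = d")
    case True
    have "multiple c u (initial \<theta> g) v \<in> two_sided_ideal hull (initial \<theta> ` G)"
      using assms(1) by (intro two_sided_ideal_mult[OF two_sided_ideal_hull]) (auto intro: hull_inc)
    then show ?thesis using *(2)[of c] True by simp
  next
    case False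
    then have "component \<theta> d (multiple c u g v) = 0"
      using *(1)[of c] assms(3) by (intro component_eq_zero) auto
    then show ?thesis by (simp add: zero_in_hull)
  qed
qed

lemma component_spanned_mem:
  assumes "p \<in> spanned lt G (degree_le d)"
  shows "component \<theta> d p \<in> two_sided_ideal hull (initial \<theta> ` G)"
  using assms
proof (induction rule: spanned.induct)
  case zero
  then show ?case by (simp add: zero_in_hull)
next
  case (step g u v q c)
  then show ?case
    using two_sided_ideal_add[OF two_sided_ideal_hull component_multiple_mem[OF step(1,2)] step.IH]
    by (simp add: component_add)
qed

text \<open>Division by \<open>G\<close> writes \<open>p\<close> as a sum of multiples of
  \<theta>-value at most that of its leading monomial; the top component of each is zero or a
  multiple of an initial.\<close>

lemma initial_mem:
  assumes gb: "groebner_basis lt G J" and p: "p \<in> J"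
  shows "initial \<theta> p \<in> two_sided_ideal hull (initial \<theta> ` G)"
proof (cases "p = 0")
  case True
  then show ?thesis by (simp add: zero_in_hull)
next
  case False
  have hull: "two_sided_ideal hull G = J"
    using gb unfolding groebner_basis_def by blast
  have J: "two_sided_ideal J" "G \<subseteq> J"
    using two_sided_ideal_hull[of G] hull_subset[of G two_sided_ideal] by (simp_all only: hull)
  obtain Q where "division lt G p Q 0"
    using lead_divisible_division[OF groebner_basis_lead_divisible[OF gb] J(2,1) p] by blast
  moreover have "keys p \<subseteq> degree_le (\<theta> (lm lt p))"
    using keys_atmost_lm[OF False] refines by auto
  ultimately have "p - 0 \<in> spanned lt G (degree_le (\<theta> (lm lt p)))"
    by (rule division_spanned[OF _ _ downset_degree_le])
  then show ?thesis
    using component_spanned_mem initial_eq_component_lm[OF False] by simp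
qed

text \<open>An ideal with homogeneous generators is graded: each term multiple of a generator is
  homogeneous, so a component keeps it or deletes it.\<close>

lemma hull_initial_graded:
  fixes G :: "('x, 'k::field) ncpoly set"
  assumes "\<forall>g\<in>G. \<exists>e. keys g \<subseteq> degree_eq e" and "p \<in> two_sided_ideal hull G"
  shows "component \<theta> d p \<in> two_sided_ideal hull G"
proof -
  have "p \<in> spanned lt G UNIV" using assms(2) hull_subset_spanned by blast
  then show ?thesis
  proof (induction rule: spanned.induct)
    case zero
    then show ?case by (simp add: zero_in_hull)
  next
    case (step g u v q c)
    let ?m = "multiple c u g v" and ?e = "\<theta> (u + lm lt g + v)"
    obtain e where "keys g \<subseteq> degree_eq e" using assms(1) step(1) by blast
    then have "\<theta> m = \<theta> (lm lt g)" if "m \<in> keys g" for m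
      using that lm_in_keys[OF step(2)] by auto
    then have m: "keys ?m \<subseteq> degree_eq ?e"
      by (intro order_trans[OF keys_term_mult_term]) (auto intro!: mult_eq)
    have "component \<theta> d ?m \<in> two_sided_ideal hull G"
    proof (cases "?e = d")
      case True
      then show ?thesis using component_eq_self[of ?m \<theta> d] m step(1)
        by (auto intro!: two_sided_ideal_mult[OF two_sided_ideal_hull] intro: hull_inc)
    next
      case False
      then have "component \<theta> d ?m = 0" using m by (intro component_eq_zero) auto
      then show ?thesis by (simp add: zero_in_hull)
    qed
    then show ?case
      using two_sided_ideal_add[OF two_sided_ideal_hull _ step.IH] by (simp add: component_add)
  qed
qed

text \<open>The tail \<open>h - initial \<theta> h\<close> lies in the graded ideal. If it were
  nonzero, its leading monomial, a monomial of \<open>h\<close>, would be divisible by that of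
  another basis element, against reducedness.\<close>

lemma reduced_groebner_basis_homogeneous:
  assumes G: "\<forall>g\<in>G. \<exists>e. keys g \<subseteq> degree_eq e"
    and H: "reduced_groebner_basis lt H (two_sided_ideal hull G)" and h: "h \<in> H"
  shows "h \<noteq> 0" and "\<exists>d. keys h \<subseteq> degree_eq d"
proof -
  have gb: "groebner_basis lt H (two_sided_ideal hull G)"
    and red: "\<And>g m u v. g \<in> H \<Longrightarrow> h \<noteq> g \<Longrightarrow> m \<in> keys h \<Longrightarrow> m \<noteq> u + lm lt g + v"
    and "lc lt h = 1"
    using H h unfolding reduced_groebner_basis_def by blast+
  \<comment> \<open>Whatever word \<open>lm\<close> returns for zero, the coefficient there is 0 and
    not 1.\<close>
  then show "h \<noteq> 0" by (auto simp: lc_def)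
  have "two_sided_ideal hull H = two_sided_ideal hull G"
    using gb unfolding groebner_basis_def by blast
  then have hJ: "h \<in> two_sided_ideal hull G"
    using hull_inc[OF h, of two_sided_ideal] by simp
  let ?q = "h - initial \<theta> h"
  have "?q = 0"
  proof (rule ccontr)
    assume q: "?q \<noteq> 0"
    have "initial \<theta> h \<in> two_sided_ideal hull G"
      unfolding initial_eq_component_lm[OF \<open>h \<noteq> 0\<close>] using G hJ by (rule hull_initial_graded)
    then have "?q \<in> two_sided_ideal hull G"
      by (rule two_sided_ideal_diff[OF two_sided_ideal_hull hJ])
    then obtain g u v where g: "g \<in> H" "lm lt ?q = u + lm lt g + v"
      using groebner_basis_lead_divisible[OF gb] q unfolding lead_divisible_def by blast
    have "keys ?q \<subseteq> below (lm lt h)"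
    proof (rule keys_diff_below)
      show "keys (initial \<theta> h) \<subseteq> atmost (lm lt h)"
        using keys_atmost_lm[OF \<open>h \<noteq> 0\<close>] by (auto simp: keys_initial)
      show "lookup h (lm lt h) = lookup (initial \<theta> h) (lm lt h)"
        using lm_in_keys_initial[OF \<open>h \<noteq> 0\<close>] by (auto simp: lookup_initial keys_initial)
    qed (rule keys_atmost_lm[OF \<open>h \<noteq> 0\<close>])
    then have "lt (lm lt ?q) (lm lt h)" using lm_in_keys[OF q] by blast
    \<comment> \<open>A factor never exceeds the word containing it, whereas \<open>lm lt h\<close>
      exceeds the leading monomial of the tail.\<close>
    then have "g \<noteq> h" using factor_le[OF g(2)] lt_trans lt_irrefl by metis
    moreover have "lm lt ?q \<in> keys h"
      using lm_in_keys[OF q] keys_diff[of h "initial \<theta> h"] by (auto simp: keys_initial)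
    ultimately show False using red g by metis
  qed
  then show "\<exists>d. keys h \<subseteq> degree_eq d"
    using initial_keys_degree[of h] by simp
qed

text \<open>The cancelled word occurs in \<open>p\<close> and so has value \<open>d\<close>;
  homogeneity of the divisor gives the whole multiple this value.\<close>

lemma division_graded:
  assumes "division lt P p Q r" and P: "\<forall>q\<in>P. \<exists>e. keys q \<subseteq> degree_eq e"
    and "keys p \<subseteq> degree_eq d"
  shows "graded_log \<theta> P d Q \<and> keys r \<subseteq> degree_eq d"
  using assms(1,3)
proof (induction rule: division.induct)
  case (division_stop p)
  then show ?case by simp
next
  case (division_step g c p u v Q r)
  let ?m = "multiple (c / lc lt g) u g v"
  have "u + lm lt g + v \<in> keys p" using division_step by (simp add: in_keys_iff)
  then have "\<theta> (u + lm lt g + v) = d" using division_step.prems by blast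
  moreover obtain e where "keys g \<subseteq> degree_eq e" using P division_step(1) by blast
  then have "\<forall>m\<in>keys g. \<theta> m = \<theta> (lm lt g)"
    using lm_in_keys[OF division_step(2)] by auto
  ultimately have g: "\<forall>m\<in>keys g. \<theta> (u + m + v) = d"
    using mult_eq by metis
  then have "keys ?m \<subseteq> degree_eq d"
    by (intro order_trans[OF keys_term_mult_term]) auto
  then have "keys (p - ?m) \<subseteq> degree_eq d"
    using division_step.prems by (intro order_trans[OF keys_diff]) simp
  then show ?case
    using division_step.IH division_step(1,2) g unfolding graded_log_Cons by blast
qed

text \<open>Shared by completion and replacement: \<open>S\<close> records the dividend, and
  \<open>P0\<close> is the set of divisors, which may omit the polynomial being reduced.\<close>

lemma log_subst_division:
  assumes K: "valid_state G' (P, K)" and S: "graded_log \<theta> P d S"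
    and div: "division lt P0 (log_sum S) Q r" and P0: "P0 \<subseteq> P"
  shows "keys r \<subseteq> degree_eq d"
    and "graded_log \<theta> G' d (log_subst K (S @ log_mult (- 1) Q 1))"
    and "log_sum (log_subst K (S @ log_mult (- 1) Q 1)) = r"
proof -
  have "\<forall>q\<in>P0. \<exists>e. keys q \<subseteq> degree_eq e" using K P0 valid_state_keys by blast
  note * = division_graded[OF div this graded_log_keys[OF S]]
  then show "keys r \<subseteq> degree_eq d" by blast
  have "graded_log \<theta> P d Q"
    using * P0 graded_log_mono by blast
  then have "graded_log \<theta> P d (log_mult (term_of (- 1) 0) Q (term_of 1 0))"
    by (rule graded_log_mult) simp
  then have "graded_log \<theta> P d (S @ log_mult (- 1) Q 1)"
    using S by (simp add: log_mult_minus_one)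
  note ** = log_subst_valid[OF K this]
  then show "graded_log \<theta> G' d (log_subst K (S @ log_mult (- 1) Q 1))" by blast
  show "log_sum (log_subst K (S @ log_mult (- 1) Q 1)) = r"
    using ** division_imp_sum[OF div] by (simp add: log_sum_append log_sum_mult)
qed

text \<open>Both halves of an S-polynomial contain the overlap word, whose \<theta>-value is
  therefore the degree of both.\<close>

lemma completion_step_valid:
  assumes "completion_step lt st st'" "valid_state G' st"
  shows "valid_state G' st'"
  using assms
proof (induction rule: completion_step.induct)
  case (1 p1 P p2 l1 r1 l2 r2 Q r K)
  let ?S = "spoly_log lt l1 p1 r1 l2 p2 r2" and ?d = "\<theta> (l1 + lm lt p1 + r1)"
  have deg: "\<theta> m = \<theta> (lm lt p)" if p: "p \<in> P" "p \<noteq> 0" "m \<in> keys p" for p m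
  proof -
    obtain e where "keys p \<subseteq> degree_eq e" using valid_state_keys[OF 1(8) p(1)] by blast
    then show ?thesis using p lm_in_keys[OF p(2)] by auto
  qed
  have "\<forall>m\<in>keys p1. \<theta> (l1 + m + r1) = ?d"
    using deg[OF 1(1,3)] mult_eq by blast
  moreover have "l1 + lm lt p1 + r1 = l2 + lm lt p2 + r2"
    using 1(5) by (simp add: overlap_def)
  then have "\<forall>m\<in>keys p2. \<theta> (l2 + m + r2) = ?d"
    using deg[OF 1(2,4)] mult_eq by metis
  ultimately have S: "graded_log \<theta> P ?d ?S"
    unfolding spoly_log_def graded_log_Cons using 1 by simp blast
  have "log_sum ?S = spoly lt l1 p1 r1 l2 p2 r2"
    by (simp add: spoly_log_def spoly_def log_sum_Cons single_uminus)
  then have "division lt P (log_sum ?S) Q r" using 1 by simp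
  note * = log_subst_division[OF 1(8) S this order_refl]
  show ?case by (rule valid_state_update[OF 1(8) order_refl *])
qed

lemma interreduction_step_valid:
  assumes "interreduction_step lt st st'" "valid_state G' st"
  shows "valid_state G' st'"
  using assms
proof (induction rule: interreduction_step.induct)
  case (discard p P Q K)
  then show ?case by (simp add: valid_state_def)
next
  case (replace p P Q r K)
  \<comment> \<open>Zero has no term to cancel, so its only remainder is zero.\<close>
  have "p \<noteq> 0"
  proof
    assume "p = 0"
    with replace(2) show False
      using replace(3) by (cases rule: division.cases) auto
  qed
  then obtain d where d: "keys p \<subseteq> degree_eq d"
    using valid_stateD[OF replace(4,1)] by blast
  have "graded_log \<theta> P d [(1, p, 1)]"
    using replace(1) \<open>p \<noteq> 0\<close> d by (rule graded_log_self)
  note * = log_subst_division[OF replace(4) this, of "P - {p}" Q r]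
  have "division lt (P - {p}) (log_sum [(1, p, 1)]) Q r"
    using replace(2) by (simp add: log_sum_Cons)
  note * = *[OF this Diff_subset]
  show ?case using valid_state_update[OF replace(4) Diff_subset *] by simp
next
  case (normalise p P r K)
  obtain d where d: "keys p \<subseteq> degree_eq d" "graded_log \<theta> G' d (K p)" "log_sum (K p) = p"
    using valid_stateD[OF normalise(4,1,2)] .
  let ?c = "inverse (lc lt p)"
  have "graded_log \<theta> G' d (log_mult (term_of ?c 0) (K p) (term_of 1 0))"
    by (rule graded_log_mult[OF d(2)]) simp
  then have L: "graded_log \<theta> G' d (log_mult (term_of ?c 0) (K p) 1)" by simp
  have "log_sum (log_mult (term_of ?c 0) (K p) 1) = r"
    by (simp add: log_sum_mult d(3) normalise(3))
  then show ?case
    using valid_state_update[OF normalise(4) Diff_subset _ L] graded_log_keys[OF L] by simp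
qed

lemma logged_groebner_basis_graded:
  assumes "logged_groebner_basis lt G' H' K" and G': "\<forall>g\<in>G'. \<exists>e. keys g \<subseteq> degree_eq e"
  shows "valid_state G' (H', K)"
proof -
  obtain P1 K1 where st: "(completion_step lt)\<^sup>*\<^sup>* (G', \<lambda>g. [(1, g, 1)]) (P1, K1)"
      "(interreduction_step lt)\<^sup>*\<^sup>* (P1, K1) (H', K)"
    using assms(1) unfolding logged_groebner_basis_def by blast
  have "valid_state G' (G', \<lambda>g. [(1, g, 1)])"
    unfolding valid_state_def prod.case
  proof (intro ballI impI)
    fix g assume g: "g \<in> G'" "g \<noteq> 0"
    obtain e where e: "keys g \<subseteq> degree_eq e" using G' g by blast
    have "graded_log \<theta> G' e [(1, g, 1)]"
      using g e by (rule graded_log_self)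
    then show "\<exists>e. keys g \<subseteq> degree_eq e \<and> graded_log \<theta> G' e [(1, g, 1)] \<and> log_sum [(1, g, 1)] = g"
      using e by (auto simp: log_sum_Cons)
  qed
  with st(1) have "valid_state G' (P1, K1)"
    by (induction rule: rtranclp_induct) (blast intro: completion_step_valid)+
  with st(2) show ?thesis
    by (induction rule: rtranclp_induct) (blast intro: interreduction_step_valid)+
qed

end

section \<open>Correctness of the Groebner walk\<close>

theorem proposition6p2p16:
  fixes lt lt' :: "'x::finite list \<Rightarrow> 'x list \<Rightarrow> bool"
    and \<theta> :: "'x list \<Rightarrow> int"
    and G H J :: "('x, 'k::field) ncpoly set"
  assumes "admissible_ordering lt" and "admissible_ordering lt'"
    and "harmonious_via TYPE('k) \<theta> lt lt'"
    and "strictly_compatible \<theta>"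
    and "finite G" and "groebner_basis lt G J"
    and "groebner_walk \<theta> lt lt' G H"
  shows "groebner_basis lt' H J"
proof -
  have grading: "grading \<theta>"
    using assms(3,4) extendible_mult_eq[where ?'k = 'k]
    unfolding grading_def strictly_compatible_def harmonious_via_def by metis
  have refines: "\<theta> a \<le> \<theta> b" if dec: "decomposition_defines N \<Theta> o'" "\<Theta> 0 = \<theta>" "o' a b" for N \<Theta> o' a b
  proof -
    obtain i where "\<Theta> i a < \<Theta> i b" "\<forall>j<i. \<Theta> j a = \<Theta> j b"
      using dec(1,3) unfolding decomposition_defines_def by metis
    \<comment> \<open>If the deciding index is 0 the inequality is strict; otherwise the values of
      \<theta> agree.\<close>
    then show ?thesis using dec(2) by (cases i) auto
  qed
  interpret O: graded_order lt \<theta>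
    using assms(1,3) grading refines
    unfolding graded_order_def graded_order_axioms_def admissible_def harmonious_via_def by blast
  interpret O': graded_order lt' \<theta>
    using assms(2,3) grading refines
    unfolding graded_order_def graded_order_axioms_def admissible_def harmonious_via_def by blast
  define G' where "G' = initial \<theta> ` G"
  obtain H' f where red: "reduced_groebner_basis lt' H' (two_sided_ideal hull G')"
    and log: "\<And>h'. h' \<in> H' \<Longrightarrow> \<exists>L. logged_representation lt lt' G' H' h' L \<and> lifts \<theta> G L (f h')"
    and H: "H = f ` H'"
    using assms(7) unfolding groebner_walk_def G'_def by blast
  have hull: "two_sided_ideal hull G = J"
    using assms(6) unfolding groebner_basis_def by blast
  then have J: "two_sided_ideal J"
    using two_sided_ideal_hull[of G] by simp
  have G': "\<forall>g\<in>G'. \<exists>e. keys g \<subseteq> {m. \<theta> m = e}"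
    using O.initial_keys_degree by (auto simp: G'_def)
  have f: "initial \<theta> (f h') = h' \<and> f h' \<in> J" if h': "h' \<in> H'" for h'
  proof -
    obtain L where L: "logged_representation lt lt' G' H' h' L" "lifts \<theta> G L (f h')"
      using log[OF h'] by blast
    have nz: "h' \<noteq> 0" and "\<exists>d. keys h' \<subseteq> {m. \<theta> m = d}"
      using O'.reduced_groebner_basis_homogeneous[OF G' red h'] .
    then obtain d where d: "keys h' \<subseteq> {m. \<theta> m = d}" by blast
    \<comment> \<open>Each of the three sources of a log consists of steps by homogeneous
      polynomials, under \<open>lt\<close> or \<open>lt'\<close>, so the log is graded.\<close>
    from L(1) have "\<exists>d. graded_log \<theta> G' d L \<and> log_sum L = h'"
      unfolding logged_representation_def
    proof (elim disjE exE conjE)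
      fix K assume "logged_groebner_basis lt' G' H' K" "L = K h'"
      then show ?thesis
        using O'.logged_groebner_basis_graded[OF _ G'] O.valid_stateD[OF _ h' nz] by blast
    next
      assume "division lt G' h' L 0"
      then show ?thesis
        using O.division_graded[OF _ G' d] division_imp_sum by fastforce
    next
      assume "division lt' G' h' L 0"
      then show ?thesis
        using O'.division_graded[OF _ G' d] division_imp_sum by fastforce
    qed
    then show ?thesis using O.lift_initial[OF _ L(2)] nz hull by blast
  qed
  have H'_div: "lead_divisible lt' H' (two_sided_ideal hull G')"
    using red by (simp add: reduced_groebner_basis_def O'.groebner_basis_lead_divisible)
  have "lead_divisible lt' H J"
    unfolding lead_divisible_def
  proof (intro ballI impI)
    fix p assume p: "p \<in> J" "p \<noteq> 0"
    \<comment> \<open>Membership comes from division under \<open>lt\<close>, for which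
      \<open>G\<close> is a basis; divisibility is then read off under \<open>lt'\<close>.\<close>
    have "initial \<theta> p \<in> two_sided_ideal hull G'" "initial \<theta> p \<noteq> 0"
      using O.initial_mem[OF assms(6) p(1)] O.initial_nonzero[OF p(2)] by (simp_all add: G'_def)
    with H'_div obtain h' u v where h': "h' \<in> H'" "h' \<noteq> 0" "lm lt' (initial \<theta> p) = u + lm lt' h' + v"
      unfolding lead_divisible_def by meson
    have "f h' \<noteq> 0" using f[OF h'(1)] h'(2) by auto
    \<comment> \<open>Both \<open>p\<close> and the lift \<open>f h'\<close> have the leading
      monomials of their initials, and the initial of the lift is \<open>h'\<close>.\<close>
    then have "lm lt' p = u + lm lt' (f h') + v"
      using O'.lm_initial[OF p(2)] O'.lm_initial[of "f h'"] f[OF h'(1)] h'(3) by simp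
    then show "\<exists>g\<in>H. \<exists>u v. g \<noteq> 0 \<and> lm lt' p = u + lm lt' g + v"
      using h'(1) \<open>f h' \<noteq> 0\<close> H by blast
  qed
  moreover have "H \<subseteq> J" using f H by blast
  ultimately show ?thesis using J by (rule O'.groebner_basisI)
qed

end
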